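(* For every $G\in\mathcal{D}$, the set $\{G,G^T\}$ is first-order definable in the poset $(\mathcal{D};\leq)$.
   Context: A digraph is a pair $G=(V,E)$ with $V$ a nonempty set and $E\subseteq V^2$ (loops allowed). Its transpose is $G^T=(V,E^{-1})$. Write $G\leq G'$ if there is an injective homomorphism $G\to G'$, i.e. an injective map of vertex sets sending edges to edges (edges need not be reflected). $\mathcal{D}$ is the set of isomorphism types of finite digraphs; it is partially ordered by $\leq$, and digraphs are identified with their isomorphism types. First-order definable means definable by a first-order formula in the language of posets, without parameters. *)

theory Defs
  imports "Graph_Theory.Graph_Theory"
begin

section \<open>Finite digraphs\<close>

text \<open>
  The library locale \<open>pair_fin_digraph\<close> allows loops, and it also allows the empty vertex set,
  which is excluded here.
\<close>

definition finite_digraph :: "'a pair_pre_digraph \<Rightarrow> bool" where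
  "finite_digraph G \<longleftrightarrow> pair_fin_digraph G \<and> pverts G \<noteq> {}"

definition transpose_digraph :: "'a pair_pre_digraph \<Rightarrow> 'a pair_pre_digraph" where
  "transpose_digraph G = \<lparr>pverts = pverts G, parcs = (parcs G)\<inverse>\<rparr>"

definition digraph_hom :: "('a \<Rightarrow> 'b) \<Rightarrow> 'a pair_pre_digraph \<Rightarrow> 'b pair_pre_digraph \<Rightarrow> bool" where
  "digraph_hom f G H \<longleftrightarrow>
     f ` pverts G \<subseteq> pverts H \<and> (\<forall>(u, v) \<in> parcs G. (f u, f v) \<in> parcs H)"

definition embeddable :: "'a pair_pre_digraph \<Rightarrow> 'b pair_pre_digraph \<Rightarrow> bool" where
  "embeddable G H \<longleftrightarrow> (\<exists>f. digraph_hom f G H \<and> inj_on f (pverts G))"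

lemma finite_digraph_iff:
  "finite_digraph G \<longleftrightarrow>
     finite (pverts G) \<and> pverts G \<noteq> {} \<and> parcs G \<subseteq> pverts G \<times> pverts G"
proof
  assume "finite_digraph G"
  then interpret pair_fin_digraph G by (simp add: finite_digraph_def)
  show "finite (pverts G) \<and> pverts G \<noteq> {} \<and> parcs G \<subseteq> pverts G \<times> pverts G"
    using \<open>finite_digraph G\<close> pair_finite_verts in_arcsD1 in_arcsD2
    by (auto simp: finite_digraph_def)
next
  assume A: "finite (pverts G) \<and> pverts G \<noteq> {} \<and> parcs G \<subseteq> pverts G \<times> pverts G"
  then have "finite (parcs G)"
    by (meson finite_SigmaI finite_subset)
  with A show "finite_digraph G"
    unfolding finite_digraph_def by (auto intro!: pair_fin_digraph.intro
        pair_wf_digraph.intro pair_fin_digraph_axioms.intro)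
qed

lemma digraph_iso_with_proj_iff:
  fixes G :: "'a pair_pre_digraph" and H :: "'b pair_pre_digraph"
  assumes "finite_digraph G"
  shows "digraph_iso (with_proj G) (with_proj H) \<longleftrightarrow>
     (\<exists>f. bij_betw f (pverts G) (pverts H) \<and> parcs H = map_prod f f ` parcs G)"
proof
  assume "digraph_iso (with_proj G) (with_proj H)"
  then obtain h where h: "pre_digraph.digraph_isomorphism (with_proj G) h"
    and H: "with_proj H = app_iso h (with_proj G)"
    by (auto simp: digraph_iso_def)
  have t: "iso_tail h = fst" "iso_head h = snd"
    and V: "pverts H = iso_verts h ` pverts G" and E: "parcs H = iso_arcs h ` parcs G"
    using arg_cong[OF H, of tail] arg_cong[OF H, of head]
      arg_cong[OF H, of verts] arg_cong[OF H, of arcs] by simp_all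
  have "iso_arcs h e = map_prod (iso_verts h) (iso_verts h) e" if "e \<in> parcs G" for e
    using h that unfolding pre_digraph.digraph_isomorphism_def
    by (auto simp: t prod_eq_iff)
  then have "parcs H = map_prod (iso_verts h) (iso_verts h) ` parcs G"
    using E by (auto intro!: image_cong)
  moreover have "bij_betw (iso_verts h) (pverts G) (pverts H)"
    using h V by (auto simp: pre_digraph.digraph_isomorphism_def bij_betw_def)
  ultimately show "\<exists>f. bij_betw f (pverts G) (pverts H) \<and> parcs H = map_prod f f ` parcs G"
    by blast
next
  assume "\<exists>f. bij_betw f (pverts G) (pverts H) \<and> parcs H = map_prod f f ` parcs G"
  then obtain f where f: "bij_betw f (pverts G) (pverts H)" "parcs H = map_prod f f ` parcs G"
    by blast
  from assms interpret pair_fin_digraph G by (simp add: finite_digraph_def)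
  let ?h = "\<lparr>iso_verts = f, iso_arcs = map_prod f f, iso_head = snd, iso_tail = fst\<rparr>"
  have "inj_on (map_prod f f) (parcs G)"
    using f(1) assms unfolding finite_digraph_iff
    by (intro inj_on_subset[OF map_prod_inj_on]) (auto simp: bij_betw_def)
  then have "pre_digraph.digraph_isomorphism (with_proj G) ?h"
    using f(1) wf_digraph_axioms
    by (auto simp: pre_digraph.digraph_isomorphism_def bij_betw_def)
  moreover have "with_proj H = app_iso ?h (with_proj G)"
    using f by (auto simp: with_proj_def app_iso_def bij_betw_def)
  ultimately show "digraph_iso (with_proj G) (with_proj H)"
    by (auto simp: digraph_iso_def)
qed

lemma embeddable_trans:
  assumes "embeddable G H" "embeddable H K"
  shows "embeddable G K"
proof -
  obtain f g where "digraph_hom f G H" "inj_on f (pverts G)"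
    "digraph_hom g H K" "inj_on g (pverts H)"
    using assms by (auto simp: embeddable_def)
  then have "digraph_hom (g \<circ> f) G K" "inj_on (g \<circ> f) (pverts G)"
    by (fastforce simp: digraph_hom_def intro!: comp_inj_on intro: inj_on_subset)+
  then show ?thesis by (auto simp: embeddable_def)
qed

lemma embeddable_if_iso:
  assumes "finite_digraph G" "digraph_iso (with_proj G) (with_proj H)"
  shows "embeddable G H"
  using assms unfolding digraph_iso_with_proj_iff[OF assms(1)] embeddable_def digraph_hom_def
  by (fastforce simp: bij_betw_def)

lemma iso_if_embeddable_both:
  assumes G: "finite_digraph G" and H: "finite_digraph H"
    and "embeddable G H" "embeddable H G"
  shows "digraph_iso (with_proj G) (with_proj H)"
proof -
  have edges: "card (parcs A) \<le> card (parcs B)" "inj_on (map_prod f f) (parcs A)"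
    "map_prod f f ` parcs A \<subseteq> parcs B" "finite (parcs B)"
    if A: "finite_digraph A" and B: "finite_digraph B"
      and f: "digraph_hom f A B" "inj_on f (pverts A)"
    for A :: "'c pair_pre_digraph" and B :: "'d pair_pre_digraph" and f
  proof -
    show inj: "inj_on (map_prod f f) (parcs A)"
      using f(2) A unfolding finite_digraph_iff
      by (intro inj_on_subset[OF map_prod_inj_on]) auto
    show sub: "map_prod f f ` parcs A \<subseteq> parcs B"
      using f(1) by (auto simp: digraph_hom_def)
    show fin: "finite (parcs B)"
      using B by (auto simp: finite_digraph_iff intro: finite_subset)
    show "card (parcs A) \<le> card (parcs B)"
      by (rule card_inj_on_le[OF inj sub fin])
  qed
  obtain f g where f: "digraph_hom f G H" "inj_on f (pverts G)"
    and g: "digraph_hom g H G" "inj_on g (pverts H)"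
    using assms by (auto simp: embeddable_def)
  note ef = edges[OF G H f] and eg = edges[OF H G g]
  have "card (pverts H) \<le> card (pverts G)"
    using g G by (auto simp: digraph_hom_def finite_digraph_iff intro!: card_inj_on_le)
  then have "f ` pverts G = pverts H"
    using f H by (intro card_seteq) (auto simp: digraph_hom_def finite_digraph_iff card_image)
  moreover have "map_prod f f ` parcs G = parcs H"
    using ef eg by (intro card_seteq) (auto simp: card_image)
  ultimately show ?thesis
    using f(2) unfolding digraph_iso_with_proj_iff[OF G] bij_betw_def
    by (intro exI[of _ f]) simp
qed

section \<open>The poset of isomorphism types\<close>

text \<open>
  Representatives are taken with natural numbers as vertices. The following lemma shows that no
  isomorphism type of finite digraphs is lost in this way.
\<close>

lemma ex_iso_nat_digraph:
  fixes G :: "'a pair_pre_digraph"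
  assumes "finite_digraph G"
  shows "\<exists>H :: nat pair_pre_digraph. finite_digraph H \<and> digraph_iso (with_proj G) (with_proj H)"
proof -
  from assms have "finite (pverts G)" by (simp add: finite_digraph_iff)
  then obtain f :: "'a \<Rightarrow> nat" where f: "inj_on f (pverts G)"
    using finite_imp_inj_to_nat_seg by metis
  let ?H = "\<lparr>pverts = f ` pverts G, parcs = map_prod f f ` parcs G\<rparr>"
  have "finite_digraph ?H"
    using assms by (auto simp: finite_digraph_iff)
  moreover have "digraph_iso (with_proj G) (with_proj ?H)"
    unfolding digraph_iso_with_proj_iff[OF assms] using f
    by (auto simp: bij_betw_def)
  ultimately show ?thesis by blast
qed

definition same_type :: "nat pair_pre_digraph \<Rightarrow> nat pair_pre_digraph \<Rightarrow> bool" where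
  "same_type G H \<longleftrightarrow>
     finite_digraph G \<and> finite_digraph H \<and> digraph_iso (with_proj G) (with_proj H)"

lemma same_type_iff_embeddable:
  "same_type G H \<longleftrightarrow>
     finite_digraph G \<and> finite_digraph H \<and> embeddable G H \<and> embeddable H G"
proof -
  have "digraph_iso (with_proj H) (with_proj G)"
    if "finite_digraph G" "digraph_iso (with_proj G) (with_proj H)"
  proof -
    from that(1) interpret pair_fin_digraph G by (simp add: finite_digraph_def)
    show ?thesis using that(2) wf_digraph_axioms by (rule digraph_iso_swap[rotated])
  qed
  then show ?thesis
    unfolding same_type_def using embeddable_if_iso iso_if_embeddable_both by blast
qed

lemma finite_digraph_transpose: "finite_digraph (transpose_digraph G) \<longleftrightarrow> finite_digraph G"
  by (auto simp: finite_digraph_iff transpose_digraph_def)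

lemma embeddable_transpose:
  "embeddable G H \<Longrightarrow> embeddable (transpose_digraph G) (transpose_digraph H)"
  by (fastforce simp: embeddable_def digraph_hom_def transpose_digraph_def)

quotient_type digraph_type = "nat pair_pre_digraph" / partial: same_type
proof (rule part_equivpI)
  have "same_type \<lparr>pverts = {0}, parcs = {}\<rparr> \<lparr>pverts = {0}, parcs = {}\<rparr>"
    unfolding same_type_iff_embeddable
    by (auto simp: finite_digraph_iff embeddable_def digraph_hom_def)
  then show "\<exists>G. same_type G G" ..
  show "symp same_type"
    by (auto simp: symp_def same_type_iff_embeddable)
  show "transp same_type"
    by (auto simp: transp_def same_type_iff_embeddable intro: embeddable_trans)
qed

instantiation digraph_type :: order
begin

lift_definition less_eq_digraph_type :: "digraph_type \<Rightarrow> digraph_type \<Rightarrow> bool" is embeddable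
  by (auto simp: same_type_iff_embeddable intro: embeddable_trans)

definition less_digraph_type :: "digraph_type \<Rightarrow> digraph_type \<Rightarrow> bool" where
  "less_digraph_type X Y \<longleftrightarrow> X \<le> Y \<and> \<not> Y \<le> X"

instance
proof
  fix X Y Z :: digraph_type
  show "X < Y \<longleftrightarrow> X \<le> Y \<and> \<not> Y \<le> X" by (rule less_digraph_type_def)
  show "X \<le> X" by transfer (auto simp: same_type_iff_embeddable)
  show "X \<le> Z" if "X \<le> Y" "Y \<le> Z" using that by transfer (rule embeddable_trans)
  show "X = Y" if "X \<le> Y" "Y \<le> X" using that
    by transfer (auto simp: same_type_iff_embeddable)
qed

end

lift_definition transpose_type :: "digraph_type \<Rightarrow> digraph_type" is transpose_digraph
  by (simp add: same_type_iff_embeddable finite_digraph_transpose embeddable_transpose)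

section \<open>First-order definability in a poset\<close>

text \<open>Variables are named by natural numbers.\<close>

datatype poset_formula =
    Eq nat nat
  | Le nat nat
  | Neg poset_formula
  | Conj poset_formula poset_formula
  | Exists nat poset_formula

primrec free_vars :: "poset_formula \<Rightarrow> nat set" where
  "free_vars (Eq x y) = {x, y}"
| "free_vars (Le x y) = {x, y}"
| "free_vars (Neg \<phi>) = free_vars \<phi>"
| "free_vars (Conj \<phi> \<psi>) = free_vars \<phi> \<union> free_vars \<psi>"
| "free_vars (Exists x \<phi>) = free_vars \<phi> - {x}"

primrec sat :: "(nat \<Rightarrow> 'a::order) \<Rightarrow> poset_formula \<Rightarrow> bool" where
  "sat s (Eq x y) \<longleftrightarrow> s x = s y"
| "sat s (Le x y) \<longleftrightarrow> s x \<le> s y"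
| "sat s (Neg \<phi>) \<longleftrightarrow> \<not> sat s \<phi>"
| "sat s (Conj \<phi> \<psi>) \<longleftrightarrow> sat s \<phi> \<and> sat s \<psi>"
| "sat s (Exists x \<phi>) \<longleftrightarrow> (\<exists>a. sat (s(x := a)) \<phi>)"

text \<open>The absence of parameters is the condition that at most \<open>x\<close> is free.\<close>

definition fo_definable :: "'a::order set \<Rightarrow> bool" where
  "fo_definable S \<longleftrightarrow>
     (\<exists>\<phi> x. free_vars \<phi> \<subseteq> {x} \<and> (\<forall>s :: nat \<Rightarrow> 'a. sat s \<phi> \<longleftrightarrow> s x \<in> S))"

end

theory Submission
  imports Defs
begin

text \<open>
  For fixed \<open>n\<close> there are only finitely many isomorphism types with at most \<open>n\<close> vertices. A
  formula can therefore say that certain elements form a down-set whose order diagram is that of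
  this finite set, and that the free variable is the element in the position of \<open>G\<close>. It defines
  the set of all \<open>f G\<close>, where \<open>f\<close> ranges over the order embeddings of the finite set onto
  down-sets (\<open>fo_definable_orbit\<close>). The identity and the transposition are such embeddings. It
  remains to choose \<open>n\<close> so large that every such \<open>f\<close> maps \<open>G\<close> to itself or to its transpose.

  An embedding \<open>f\<close> of this kind is a permutation that preserves the numbers of vertices and edges.
  It maps the digraph \<open>loop_out\<close>, a loop with an edge leaving it, to itself or to its transpose.
  After composition with the transposition \<open>loop_out\<close> is fixed, and this orients everything else:
  \<open>f\<close> also fixes the out-star with two leaves, so it respects whether two edges have the same
  tail. Hence it preserves \<open>\<Sum>v. min (outdeg v) t\<close> for every \<open>t\<close>, that is, the sequence of
  out-degrees (\<open>outdeg_sum_f\<close>), and by symmetry that of in-degrees.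

  Out-degrees can be used as names of vertices. Take a disjoint union of out-stars whose sizes are
  far apart. The degree sequences determine it (\<open>f_forest\<close>), and also every digraph obtained from
  it by adding one edge between two centres (\<open>f_forest_edge\<close>). Since the centres are recognised by
  their out-degrees, any set of edges between the centres may be added (\<open>f_forest_edges\<close>). So \<open>f\<close>
  fixes the digraph obtained from \<open>G\<close> by attaching many pendant vertices, in widely different
  numbers, to its vertices. Finally the pendants are removed again, one vertex of \<open>G\<close> after the
  other (\<open>strip_pendants\<close>). The image of the smaller digraph lies below the larger one, which is
  fixed. If it used \<open>q\<close> of the pendants that are being removed, then the out-degree sequence would
  force the missing \<open>q\<close> edges to leave the same vertex, and the number of isolated vertices would
  force them to end in \<open>q\<close> distinct vertices without other edges. So the image is the smaller
  digraph after all.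
\<close>

section \<open>Isomorphism types of digraphs on arbitrary vertices\<close>

definition digraph_on :: "'a set \<Rightarrow> ('a \<times> 'a) set \<Rightarrow> bool" where
  "digraph_on V E \<longleftrightarrow> finite V \<and> V \<noteq> {} \<and> E \<subseteq> V \<times> V"

lemma digraph_onI: "finite V \<Longrightarrow> V \<noteq> {} \<Longrightarrow> E \<subseteq> V \<times> V \<Longrightarrow> digraph_on V E"
  by (simp add: digraph_on_def)

lemma digraph_onD:
  assumes "digraph_on V E"
  shows "finite V" "V \<noteq> {}" "E \<subseteq> V \<times> V" "finite E" "Field E \<subseteq> V"
  using assms by (auto simp: digraph_on_def Field_def intro: finite_subset)

text \<open>
  The vertices may come from any type. The constructions below use pairs as vertices, so that
  pendant vertices can be added without coding them as natural numbers.
\<close>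

definition iso_type :: "'a set \<Rightarrow> ('a \<times> 'a) set \<Rightarrow> digraph_type" where
  "iso_type V E = abs_digraph_type (SOME H. finite_digraph H \<and>
     digraph_iso (with_proj \<lparr>pverts = V, parcs = E\<rparr>) (with_proj H))"

lemma iso_type_rep:
  assumes "digraph_on V E"
  obtains H where "same_type H H" "iso_type V E = abs_digraph_type H"
    "digraph_iso (with_proj \<lparr>pverts = V, parcs = E\<rparr>) (with_proj H)"
proof -
  have fin: "finite_digraph \<lparr>pverts = V, parcs = E\<rparr>"
    using assms by (simp add: finite_digraph_iff digraph_on_def)
  let ?P = "\<lambda>H :: nat pair_pre_digraph. finite_digraph H \<and>
    digraph_iso (with_proj \<lparr>pverts = V, parcs = E\<rparr>) (with_proj H)"
  have H: "?P (SOME H. ?P H)"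
    using ex_iso_nat_digraph[OF fin] by (rule someI_ex)
  then have "same_type (SOME H. ?P H) (SOME H. ?P H)"
    by (auto simp: same_type_iff_embeddable embeddable_def digraph_hom_def
        intro!: exI[of _ id])
  with H show thesis by (auto intro: that simp: iso_type_def)
qed

lemma bij_of_iso:
  assumes "digraph_on V E" "digraph_iso (with_proj \<lparr>pverts = V, parcs = E\<rparr>) (with_proj H)"
  obtains g where "bij_betw g V (pverts H)" "parcs H = map_prod g g ` E"
  using assms digraph_iso_with_proj_iff[of "\<lparr>pverts = V, parcs = E\<rparr>" H]
  by (auto simp: finite_digraph_iff digraph_on_def)

lemma embeddable_iff:
  "embeddable G H \<longleftrightarrow> (\<exists>g. inj_on g (pverts G) \<and> g ` pverts G \<subseteq> pverts H \<and> map_prod g g ` parcs G \<subseteq> parcs H)"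
proof -
  have "(\<forall>(u, v) \<in> parcs G. (g u, g v) \<in> parcs H) \<longleftrightarrow> map_prod g g ` parcs G \<subseteq> parcs H" for g
    by auto
  then show ?thesis unfolding embeddable_def digraph_hom_def by auto
qed

lemma iso_embeddable:
  assumes "digraph_on V E" "digraph_iso (with_proj \<lparr>pverts = V, parcs = E\<rparr>) (with_proj H)"
  shows "embeddable \<lparr>pverts = V, parcs = E\<rparr> H" "embeddable H \<lparr>pverts = V, parcs = E\<rparr>"
proof -
  obtain g where g: "bij_betw g V (pverts H)" "parcs H = map_prod g g ` E"
    using bij_of_iso[OF assms] .
  then show "embeddable \<lparr>pverts = V, parcs = E\<rparr> H"
    unfolding embeddable_iff by (auto simp: bij_betw_def intro!: exI[of _ g])
  let ?h = "the_inv_into V g"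
  have "map_prod ?h ?h ` parcs H \<subseteq> E"
    using g digraph_onD(3)[OF assms(1)] by (auto simp: bij_betw_def the_inv_into_f_f subset_iff)
  then show "embeddable H \<lparr>pverts = V, parcs = E\<rparr>"
    using bij_betw_the_inv_into[OF g(1)] unfolding embeddable_iff
    by (auto simp: bij_betw_def intro!: exI[of _ ?h])
qed

lemma iso_type_le_iff:
  assumes "digraph_on V E" "digraph_on V' E'"
  shows "iso_type V E \<le> iso_type V' E' \<longleftrightarrow>
    (\<exists>g. inj_on g V \<and> g ` V \<subseteq> V' \<and> map_prod g g ` E \<subseteq> E')"
proof -
  obtain H where H: "same_type H H" "iso_type V E = abs_digraph_type H"
    "digraph_iso (with_proj \<lparr>pverts = V, parcs = E\<rparr>) (with_proj H)"
    using iso_type_rep[OF assms(1)] .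
  obtain H' where H': "same_type H' H'" "iso_type V' E' = abs_digraph_type H'"
    "digraph_iso (with_proj \<lparr>pverts = V', parcs = E'\<rparr>) (with_proj H')"
    using iso_type_rep[OF assms(2)] .
  have "iso_type V E \<le> iso_type V' E' \<longleftrightarrow> embeddable H H'"
    unfolding H(2) H'(2) using H(1) H'(1) by (rule less_eq_digraph_type.abs_eq)
  also have "\<dots> \<longleftrightarrow> embeddable \<lparr>pverts = V, parcs = E\<rparr> \<lparr>pverts = V', parcs = E'\<rparr>"
  proof
    assume "embeddable H H'"
    then show "embeddable \<lparr>pverts = V, parcs = E\<rparr> \<lparr>pverts = V', parcs = E'\<rparr>"
      by (rule embeddable_trans[OF iso_embeddable(1)[OF assms(1) H(3)]
            embeddable_trans[OF _ iso_embeddable(2)[OF assms(2) H'(3)]]])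
  next
    assume "embeddable \<lparr>pverts = V, parcs = E\<rparr> \<lparr>pverts = V', parcs = E'\<rparr>"
    then show "embeddable H H'"
      by (rule embeddable_trans[OF iso_embeddable(2)[OF assms(1) H(3)]
            embeddable_trans[OF _ iso_embeddable(1)[OF assms(2) H'(3)]]])
  qed
  finally show ?thesis by (simp add: embeddable_iff)
qed

lemma same_type_bij:
  assumes "same_type G H"
  obtains g where "bij_betw g (pverts G) (pverts H)" "parcs H = map_prod g g ` parcs G"
    "parcs G \<subseteq> pverts G \<times> pverts G"
  using assms digraph_iso_with_proj_iff[of G H] by (auto simp: same_type_def finite_digraph_iff)

lemma ex_iso_type_aux: "\<exists>(V :: nat set) E. digraph_on V E \<and> X = iso_type V E"
proof (induction X rule: digraph_type.abs_induct)
  case (1 G)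
  then have ok: "digraph_on (pverts G) (parcs G)"
    by (simp add: same_type_iff_embeddable finite_digraph_iff digraph_on_def)
  obtain H where H: "same_type H H" "iso_type (pverts G) (parcs G) = abs_digraph_type H"
    "digraph_iso (with_proj \<lparr>pverts = pverts G, parcs = parcs G\<rparr>) (with_proj H)"
    by (rule iso_type_rep[OF ok])
  have "same_type G H"
    using H(1,3) 1 by (cases G) (simp add: same_type_def)
  then have "abs_digraph_type G = iso_type (pverts G) (parcs G)"
    unfolding H(2) using Quotient_rel_abs[OF Quotient_digraph_type] by blast
  with ok show ?case by blast
qed

lemma ex_iso_type:
  obtains V :: "nat set" and E where "digraph_on V E" "X = iso_type V E"
  using ex_iso_type_aux[of X] by blast

lift_definition nverts :: "digraph_type \<Rightarrow> nat" is "\<lambda>G. card (pverts G)"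
  by (erule same_type_bij) (rule bij_betw_same_card)

lemma inj_map_prod: "inj_on g V \<Longrightarrow> E \<subseteq> V \<times> V \<Longrightarrow> inj_on (map_prod g g) E"
  using map_prod_inj_on inj_on_subset by blast

lift_definition nedges :: "digraph_type \<Rightarrow> nat" is "\<lambda>G. card (parcs G)"
proof -
  fix G H assume "same_type G H"
  then obtain g where g: "bij_betw g (pverts G) (pverts H)" "parcs H = map_prod g g ` parcs G"
    "parcs G \<subseteq> pverts G \<times> pverts G" by (rule same_type_bij)
  then show "card (parcs G) = card (parcs H)"
    using inj_map_prod[OF bij_betw_imp_inj_on[OF g(1)] g(3)] by (simp add: card_image)
qed

lemma card_Field_map_prod:
  assumes "inj_on g (Field E)"
  shows "card (Field (map_prod g g ` E)) = card (Field E)"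
proof -
  have "Field (map_prod g g ` E) = g ` Field E"
    unfolding Field_def by force
  with assms show ?thesis by (simp add: card_image)
qed

text \<open>
  Counting these vertices amounts to counting the isolated ones, whose number has to be preserved
  as well when pendant vertices are removed.
\<close>

lift_definition nsupport :: "digraph_type \<Rightarrow> nat" is "\<lambda>G. card (Field (parcs G))"
proof -
  fix G H assume "same_type G H"
  then obtain g where g: "bij_betw g (pverts G) (pverts H)" "parcs H = map_prod g g ` parcs G"
    "parcs G \<subseteq> pverts G \<times> pverts G" by (rule same_type_bij)
  then have "inj_on g (Field (parcs G))"
    by (auto simp: bij_betw_def Field_def intro: inj_on_subset)
  then show "card (Field (parcs G)) = card (Field (parcs H))"
    by (simp add: g(2) card_Field_map_prod)
qed

lemma Image_map_prod:
  assumes "inj_on g V" "E \<subseteq> V \<times> V" "v \<in> V"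
  shows "(map_prod g g ` E) `` {g v} = g ` (E `` {v})"
proof -
  have "w = v" if "(w, b) \<in> E" "g w = g v" for w b
    using that assms by (meson SigmaD1 inj_onD subsetD)
  then show ?thesis by (force simp: image_iff Image_def)
qed

abbreviation outdeg :: "('a \<times> 'a) set \<Rightarrow> 'a \<Rightarrow> nat" where
  "outdeg E v \<equiv> card (E `` {v})"

lemma sum_outdeg_bij:
  assumes "bij_betw g V V'" "E \<subseteq> V \<times> V"
  shows "(\<Sum>v\<in>V'. min (outdeg (map_prod g g ` E) v) t) = (\<Sum>v\<in>V. min (outdeg E v) t)"
proof -
  have inj: "inj_on g V" using assms by (simp add: bij_betw_def)
  have "outdeg (map_prod g g ` E) (g v) = outdeg E v" if "v \<in> V" for v
  proof -
    have "inj_on g (E `` {v})" using inj assms(2) by (auto intro: inj_on_subset)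
    then show ?thesis
      unfolding Image_map_prod[OF inj assms(2) that] by (rule card_image)
  qed
  then show ?thesis
    unfolding sum.reindex_bij_betw[OF assms(1), symmetric] by (intro sum.cong) auto
qed

text \<open>
  As a function of the cut-off \<open>t\<close> this is the out-degree sequence in another form: the increment
  from \<open>t\<close> to \<open>Suc t\<close> is the number of vertices of out-degree greater than \<open>t\<close>. This form is
  chosen because it is the maximal number of edges of a subgraph with out-degrees at most \<open>t\<close>, and
  so can be described by the order.
\<close>

lift_definition outdeg_sum :: "nat \<Rightarrow> digraph_type \<Rightarrow> nat" is
  "\<lambda>t G. \<Sum>v\<in>pverts G. min (outdeg (parcs G) v) t"
  by (erule same_type_bij) (simp add: sum_outdeg_bij)

lemma iso_type_rep_bij:
  assumes "digraph_on V E"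
  obtains H g where "same_type H H" "iso_type V E = abs_digraph_type H" "bij_betw g V (pverts H)"
    "parcs H = map_prod g g ` E"
proof -
  obtain H where H: "same_type H H" "iso_type V E = abs_digraph_type H"
    "digraph_iso (with_proj \<lparr>pverts = V, parcs = E\<rparr>) (with_proj H)"
    by (rule iso_type_rep[OF assms])
  obtain g where "bij_betw g V (pverts H)" "parcs H = map_prod g g ` E"
    by (rule bij_of_iso[OF assms H(3)])
  with H(1,2) show thesis by (rule that)
qed

lemma nverts_iso_type [simp]: assumes "digraph_on V E" shows "nverts (iso_type V E) = card V"
proof -
  obtain H g where H: "same_type H H" "iso_type V E = abs_digraph_type H" "bij_betw g V (pverts H)"
    "parcs H = map_prod g g ` E"
    by (rule iso_type_rep_bij[OF assms])
  then show ?thesis by (simp add: nverts.abs_eq bij_betw_same_card)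
qed

lemma nedges_iso_type [simp]: assumes "digraph_on V E" shows "nedges (iso_type V E) = card E"
proof -
  obtain H g where H: "same_type H H" "iso_type V E = abs_digraph_type H" "bij_betw g V (pverts H)"
    "parcs H = map_prod g g ` E"
    by (rule iso_type_rep_bij[OF assms])
  with inj_map_prod[of g V E] digraph_onD(3)[OF assms] show ?thesis
    by (simp add: nedges.abs_eq card_image bij_betw_def)
qed

lemma nsupport_iso_type [simp]: assumes "digraph_on V E"
  shows "nsupport (iso_type V E) = card (Field E)"
proof -
  obtain H g where H: "same_type H H" "iso_type V E = abs_digraph_type H" "bij_betw g V (pverts H)"
    "parcs H = map_prod g g ` E"
    by (rule iso_type_rep_bij[OF assms])
  have "inj_on g (Field E)"
    using H(3) digraph_onD(5)[OF assms] by (auto simp: bij_betw_def intro: inj_on_subset)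
  with H show ?thesis
    by (simp add: nsupport.abs_eq card_Field_map_prod)
qed

lemma outdeg_sum_iso_type [simp]:
  assumes "digraph_on V E" shows "outdeg_sum t (iso_type V E) = (\<Sum>v\<in>V. min (outdeg E v) t)"
proof -
  obtain H g where H: "same_type H H" "iso_type V E = abs_digraph_type H" "bij_betw g V (pverts H)"
    "parcs H = map_prod g g ` E"
    by (rule iso_type_rep_bij[OF assms])
  then show ?thesis using digraph_onD(3)[OF assms] by (simp add: outdeg_sum.abs_eq sum_outdeg_bij)
qed

text \<open>
  An injective homomorphism between finite digraphs is onto if the numbers agree.
\<close>

lemma iso_type_eqI_card:
  assumes "X \<le> Y" "nverts X = nverts Y" "nedges X = nedges Y"
  shows "X = Y"
proof -
  obtain V :: "nat set" and E where X: "digraph_on V E" "X = iso_type V E" by (rule ex_iso_type)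
  obtain V' :: "nat set" and E' where Y: "digraph_on V' E'" "Y = iso_type V' E'"
    by (rule ex_iso_type)
  obtain g where g: "inj_on g V" "g ` V \<subseteq> V'" "map_prod g g ` E \<subseteq> E'"
    using assms(1) X Y by (auto simp: iso_type_le_iff)
  have V: "g ` V = V'"
    using assms(2) X Y g digraph_onD(1)[OF Y(1)] by (intro card_seteq) (simp_all add: card_image)
  have E: "map_prod g g ` E = E'"
    using assms(3) X Y g digraph_onD(4)[OF Y(1)] digraph_onD(3)[OF X(1)] inj_map_prod[OF g(1)]
    by (intro card_seteq) (simp_all add: card_image)
  let ?h = "the_inv_into V g"
  have "inj_on ?h V'" "?h ` V' \<subseteq> V"
    using g(1) V by (auto simp: inj_on_the_inv_into the_inv_into_f_f)
  moreover have "map_prod ?h ?h ` E' \<subseteq> E"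
    using g(1) E digraph_onD(3)[OF X(1)] by (auto simp: the_inv_into_f_f subset_iff)
  ultimately have "Y \<le> X"
    unfolding X(2) Y(2) iso_type_le_iff[OF Y(1) X(1)] by blast
  with assms(1) show ?thesis by simp
qed

lemma le_iso_typeE:
  fixes V :: "'a set"
  assumes "X \<le> iso_type V E" "digraph_on V E"
  obtains V' E' where "digraph_on V' E'" "V' \<subseteq> V" "E' \<subseteq> E" "X = iso_type V' E'"
proof -
  obtain W :: "nat set" and F where X: "digraph_on W F" "X = iso_type W F" by (rule ex_iso_type)
  obtain g where g: "inj_on g W" "g ` W \<subseteq> V" "map_prod g g ` F \<subseteq> E"
    using assms X by (auto simp: iso_type_le_iff)
  have ok: "digraph_on (g ` W) (map_prod g g ` F)" using X(1) by (auto simp: digraph_on_def)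
  have "X \<le> iso_type (g ` W) (map_prod g g ` F)"
    using X ok g(1) by (auto simp: iso_type_le_iff)
  then have "X = iso_type (g ` W) (map_prod g g ` F)"
    using X g(1) inj_map_prod[OF g(1) digraph_onD(3)[OF X(1)]] ok
    by (intro iso_type_eqI_card) (simp_all add: card_image)
  with g(2,3) ok show thesis by (intro that)
qed

lemma iso_type_mono:
  assumes "digraph_on V' E'" "V \<subseteq> V'" "E \<subseteq> E'" "E \<subseteq> V \<times> V" "V \<noteq> {}"
  shows "iso_type V E \<le> iso_type V' E'"
proof -
  have "digraph_on V E" using assms(2,4,5) digraph_onD(1)[OF assms(1)]
    by (intro digraph_onI) (rule finite_subset)
  with assms show ?thesis by (auto simp: iso_type_le_iff intro!: exI[of _ id])
qed

text \<open>
  Isolated vertices carry no information beyond their number, so only the edges have to be mapped.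
\<close>

lemma iso_type_eqI:
  assumes "digraph_on V E" "digraph_on V' E'" "card V = card V'" "card E = card E'"
    and "inj_on g (Field E)" "map_prod g g ` E \<subseteq> E'"
  shows "iso_type V E = iso_type V' E'"
proof -
  let ?F = "Field E"
  note F = digraph_onD(5)[OF assms(1)]
  have gF: "g ` ?F \<subseteq> V'" using digraph_onD(3)[OF assms(2)] assms(6) by (fastforce simp: Field_def)
  have fin: "finite V" "finite V'" "finite ?F"
    using digraph_onD(1)[OF assms(1)] digraph_onD(1)[OF assms(2)] F finite_subset by auto
  have "card (V - ?F) = card (V' - g ` ?F)"
    using F gF fin assms(3,5) by (simp add: card_Diff_subset card_image)
  then obtain h where h: "bij_betw h (V - ?F) (V' - g ` ?F)"
    using fin by (metis finite_Diff finite_same_card_bij)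
  let ?k = "\<lambda>v. if v \<in> ?F then g v else h v"
  have "inj_on h (V - ?F)" and hV: "h ` (V - ?F) = V' - g ` ?F"
    using h by (auto simp: bij_betw_def)
  then have "inj_on ?k (?F \<union> (V - ?F))"
    using assms(5) by (intro inj_on_disjoint_Un) auto
  then have "inj_on ?k V" using F by (simp add: Un_absorb1)
  moreover have "?k ` V \<subseteq> V'"
  proof
    fix y assume "y \<in> ?k ` V"
    then show "y \<in> V'" using hV gF by (auto split: if_splits)
  qed
  moreover have "map_prod ?k ?k ` E = map_prod g g ` E"
    by (intro image_cong) (auto simp: Field_def)
  then have "map_prod ?k ?k ` E \<subseteq> E'"
    using assms(6) by simp
  ultimately have "iso_type V E \<le> iso_type V' E'"
    unfolding iso_type_le_iff[OF assms(1,2)] by blast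
  then show ?thesis using assms by (intro iso_type_eqI_card) simp_all
qed

lemma digraph_on_converse: "digraph_on V E \<Longrightarrow> digraph_on V (E\<inverse>)"
  by (auto simp: digraph_on_def)

lemma transpose_iso_type [simp]:
  assumes "digraph_on V E" shows "transpose_type (iso_type V E) = iso_type V (E\<inverse>)"
proof -
  obtain H g where H: "same_type H H" "iso_type V E = abs_digraph_type H" "bij_betw g V (pverts H)"
    "parcs H = map_prod g g ` E"
    by (rule iso_type_rep_bij[OF assms])
  obtain H' g'
    where H': "same_type H' H'" "iso_type V (E\<inverse>) = abs_digraph_type H'" "bij_betw g' V (pverts H')"
    "parcs H' = map_prod g' g' ` (E\<inverse>)"
    by (rule iso_type_rep_bij[OF digraph_on_converse[OF assms]])
  let ?h = "g' \<circ> the_inv_into V g"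
  have "bij_betw ?h (pverts H) (pverts H')"
    using H(3) H'(3) bij_betw_the_inv_into bij_betw_trans by blast
  moreover have "map_prod ?h ?h ` ((parcs H)\<inverse>) \<subseteq> parcs H'"
    using H(3,4) H'(4) digraph_onD(3)[OF assms]
    by (fastforce simp: bij_betw_def the_inv_into_f_f subset_iff)
  ultimately have "embeddable (transpose_digraph H) H'"
    by (auto simp: embeddable_iff transpose_digraph_def bij_betw_def intro!: exI[of _ ?h])
  then have "transpose_type (iso_type V E) \<le> iso_type V (E\<inverse>)"
    using H(1,2) H'(1,2)
    by (simp add: transpose_type.abs_eq less_eq_digraph_type.abs_eq same_type_iff_embeddable
        finite_digraph_transpose embeddable_transpose)
  moreover have "same_type (transpose_digraph H) (transpose_digraph H)"
    using H(1) by (simp add: same_type_iff_embeddable finite_digraph_transpose embeddable_transpose)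
  then have "nverts (transpose_type (iso_type V E)) = nverts (iso_type V E)"
    "nedges (transpose_type (iso_type V E)) = nedges (iso_type V E)"
    using H(1,2)
    by (simp_all add: transpose_type.abs_eq nverts.abs_eq nedges.abs_eq transpose_digraph_def)
  moreover note digraph_on_converse[OF assms]
  ultimately show ?thesis
    using assms by (intro iso_type_eqI_card) simp_all
qed

lemma transpose_transpose [simp]: "transpose_type (transpose_type X) = X"
proof (rule ex_iso_type[of X])
  fix V :: "nat set" and E assume X: "digraph_on V E" "X = iso_type V E"
  with digraph_on_converse[OF X(1)] show ?thesis by simp
qed

lemma transpose_mono: "X \<le> Y \<Longrightarrow> transpose_type X \<le> transpose_type Y"
  by transfer (rule embeddable_transpose)

lemma transpose_le_iff [simp]: "transpose_type X \<le> transpose_type Y \<longleftrightarrow> X \<le> Y"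
  using transpose_mono transpose_transpose by metis

lemma nverts_mono: assumes "X \<le> Y" shows "nverts X \<le> nverts Y"
proof -
  obtain V :: "nat set" and E where Y: "digraph_on V E" "Y = iso_type V E" by (rule ex_iso_type)
  obtain V' E' where "digraph_on V' E'" "V' \<subseteq> V" "X = iso_type V' E'"
    by (rule le_iso_typeE[OF assms[unfolded Y(2)] Y(1)])
  with Y digraph_onD(1)[OF Y(1)] show ?thesis by (simp add: card_mono)
qed

lemma nedges_mono: assumes "X \<le> Y" shows "nedges X \<le> nedges Y"
proof -
  obtain V :: "nat set" and E where Y: "digraph_on V E" "Y = iso_type V E" by (rule ex_iso_type)
  obtain V' E' where "digraph_on V' E'" "E' \<subseteq> E" "X = iso_type V' E'"
    by (rule le_iso_typeE[OF assms[unfolded Y(2)] Y(1)])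
  with Y digraph_onD(4)[OF Y(1)] show ?thesis by (simp add: card_mono)
qed

lemma nverts_transpose [simp]: "nverts (transpose_type X) = nverts X"
  and nedges_transpose [simp]: "nedges (transpose_type X) = nedges X"
proof -
  obtain V :: "nat set" and E where X: "digraph_on V E" "X = iso_type V E" by (rule ex_iso_type)
  with digraph_on_converse[OF X(1)] show "nverts (transpose_type X) = nverts X"
    "nedges (transpose_type X) = nedges X"
    by (simp_all add: card_inverse)
qed

section \<open>Definability by finite order diagrams\<close>

text \<open>
  The empty conjunction is a tautology in the variable \<open>k\<close>, which is the free variable of the
  formula to be built.
\<close>

primrec conjs :: "nat \<Rightarrow> poset_formula list \<Rightarrow> poset_formula" where
  "conjs k [] = Eq k k"
| "conjs k (\<phi> # \<phi>s) = Conj \<phi> (conjs k \<phi>s)"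

lemma sat_conjs: "sat s (conjs k \<phi>s) \<longleftrightarrow> (\<forall>\<phi>\<in>set \<phi>s. sat s \<phi>)"
  by (induction \<phi>s) auto

lemma free_vars_conjs: "free_vars (conjs k \<phi>s) \<subseteq> {k} \<union> (\<Union>\<phi>\<in>set \<phi>s. free_vars \<phi>)"
  by (induction \<phi>s) auto

primrec exs :: "nat \<Rightarrow> poset_formula \<Rightarrow> poset_formula" where
  "exs 0 \<phi> = \<phi>"
| "exs (Suc k) \<phi> = exs k (Exists k \<phi>)"

lemma sat_exs: "sat s (exs k \<phi>) \<longleftrightarrow> (\<exists>t. (\<forall>v\<ge>k. t v = s v) \<and> sat t \<phi>)"
proof (induction k arbitrary: \<phi>)
  case 0
  have "t = s" if "\<forall>v. t v = s v" for t using that by auto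
  then show ?case by auto
next
  case (Suc k)
  have "(\<exists>t. (\<forall>v\<ge>k. t v = s v) \<and> (\<exists>a. sat (t(k := a)) \<phi>)) \<longleftrightarrow>
    (\<exists>t. (\<forall>v\<ge>Suc k. t v = s v) \<and> sat t \<phi>)" (is "?l \<longleftrightarrow> ?r")
  proof
    assume ?l
    then obtain t a where "\<forall>v\<ge>k. t v = s v" "sat (t(k := a)) \<phi>" by blast
    then show ?r by (intro exI[of _ "t(k := a)"]) auto
  next
    assume ?r
    then obtain t where t: "\<forall>v\<ge>Suc k. t v = s v" "sat t \<phi>" by blast
    have "(t(k := s k))(k := t k) = t" by simp
    with t show ?l
      by (intro exI[of _ "t(k := s k)"] conjI exI[of _ "t k"]) (auto simp: Suc_le_eq)
  qed
  with Suc.IH show ?case by simp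
qed

lemma free_vars_exs: "free_vars (exs k \<phi>) = free_vars \<phi> - {..<k}"
  by (induction k arbitrary: \<phi>) (auto simp: lessThan_Suc)

definition downset_embedding :: "'a::order set \<Rightarrow> ('a \<Rightarrow> 'a) \<Rightarrow> bool" where
  "downset_embedding P f \<longleftrightarrow> (\<forall>X\<in>P. \<forall>Y\<in>P. f X \<le> f Y \<longleftrightarrow> X \<le> Y) \<and> (\<forall>X\<in>P. \<forall>Z\<le>f X. Z \<in> f ` P)"

text \<open>
  Let \<open>k\<close> be the number of elements of \<open>P\<close>. The variables below \<open>k\<close> enumerate the image of \<open>P\<close>.
  Variable \<open>k\<close> is free, and variable \<open>Suc k\<close> serves to say that the enumerated elements form a
  down-set.
\<close>

theorem fo_definable_orbit:
  fixes P :: "'a::order set"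
  assumes "finite P" "G \<in> P"
  shows "fo_definable {f G | f. downset_embedding P f}"
proof -
  define k where "k = card P"
  obtain p where p: "bij_betw p {..<k} P"
    using assms(1) finite_same_card_bij[of "{..<k}" P] by (auto simp: k_def)
  obtain g where g: "g < k" "p g = G" using p assms(2) by (auto simp: bij_betw_def)
  define diagram
    where "diagram = [if p i \<le> p j then Le i j else Neg (Le i j). i \<leftarrow> [0..<k], j \<leftarrow> [0..<k]]"
  define closed where "closed = [Neg (Exists (Suc k) (Conj (Le (Suc k) i)
      (conjs k [Neg (Eq (Suc k) j). j \<leftarrow> [0..<k]]))). i \<leftarrow> [0..<k]]"
  define \<phi> where "\<phi> = exs k (conjs k (Eq k g # diagram @ closed))"
  have "free_vars \<phi> \<subseteq> {k}"
    unfolding \<phi>_def free_vars_exs using g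
    by (auto simp: diagram_def closed_def dest!: subsetD[OF free_vars_conjs] split: if_splits)
  moreover have "sat s \<phi> \<longleftrightarrow> s k \<in> {f G | f. downset_embedding P f}" for s
  proof -
    have diagram: "(\<forall>\<psi>\<in>set diagram. sat t \<psi>) \<longleftrightarrow> (\<forall>i<k. \<forall>j<k. t i \<le> t j \<longleftrightarrow> p i \<le> p j)"
      for t :: "nat \<Rightarrow> 'a"
    proof -
      have "set diagram = (\<Union>i\<in>{..<k}. (\<lambda>j. if p i \<le> p j then Le i j else Neg (Le i j)) ` {..<k})"
        unfolding diagram_def by (simp add: atLeast0LessThan)
      moreover have "sat t (if p i \<le> p j then Le i j else Neg (Le i j)) \<longleftrightarrow>
          (t i \<le> t j \<longleftrightarrow> p i \<le> p j)" for i j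
        by simp
      ultimately show ?thesis by (simp only: ball_UN ball_simps) (simp only: Ball_def lessThan_iff)
    qed
    have closed: "(\<forall>\<psi>\<in>set closed. sat t \<psi>) \<longleftrightarrow> (\<forall>i<k. \<forall>z\<le>t i. \<exists>j<k. z = t j)"
      for t :: "nat \<Rightarrow> 'a"
    proof -
      have "sat t (Neg (Exists (Suc k) (Conj (Le (Suc k) i) (conjs k [Neg (Eq (Suc k) j). j \<leftarrow> [0..<k]]))))
        \<longleftrightarrow> (\<forall>z\<le>t i. \<exists>j<k. z = t j)" if "i < k" for i
        using that by (simp add: sat_conjs Bex_def)
      then show ?thesis unfolding closed_def by (auto simp: Ball_def simp del: sat.simps)
    qed
    have "sat s \<phi> \<longleftrightarrow> (\<exists>t. (\<forall>v\<ge>k. t v = s v) \<and> t k = t g \<and>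
        (\<forall>i<k. \<forall>j<k. t i \<le> t j \<longleftrightarrow> p i \<le> p j) \<and> (\<forall>i<k. \<forall>z\<le>t i. \<exists>j<k. z = t j))"
      unfolding \<phi>_def sat_exs
      by (simp add: sat_conjs ball_Un diagram closed)
    also have "\<dots> \<longleftrightarrow> (\<exists>f. s k = f G \<and> downset_embedding P f)"
    proof safe
      fix t assume t: "\<forall>v\<ge>k. t v = s v" "t k = t g"
        "\<forall>i<k. \<forall>j<k. t i \<le> t j \<longleftrightarrow> p i \<le> p j" "\<forall>i<k. \<forall>z\<le>t i. \<exists>j<k. z = t j"
      let ?q = "the_inv_into {..<k} p"
      have q: "?q X < k" "p (?q X) = X" if "X \<in> P" for X
        using that p bij_betw_the_inv_into[OF p] f_the_inv_into_f_bij_betw[OF p]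
        by (auto simp: bij_betw_def)
      have qp: "?q (p i) = i" if "i < k" for i
        using that p by (simp add: bij_betw_def the_inv_into_f_f)
      have "downset_embedding P (t \<circ> ?q)"
        unfolding downset_embedding_def
      proof (intro conjI ballI allI impI)
        fix X Y assume "X \<in> P" "Y \<in> P"
        then show "(t \<circ> ?q) X \<le> (t \<circ> ?q) Y \<longleftrightarrow> X \<le> Y"
          using t(3)[rule_format, OF q(1) q(1), of X Y] q(2) by simp
      next
        fix X Z assume X: "X \<in> P" and "Z \<le> (t \<circ> ?q) X"
        then obtain j where j: "j < k" "Z = t j"
          using t(4)[rule_format, OF q(1)[OF X], of Z] by auto
        then have "Z = (t \<circ> ?q) (p j)" "p j \<in> P"
          using qp p by (auto simp: bij_betw_def)
        then show "Z \<in> (t \<circ> ?q) ` P" by (rule image_eqI)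
      qed
      moreover have "s k = (t \<circ> ?q) G" using t(1,2) g qp by auto
      ultimately show "\<exists>f. s k = f G \<and> downset_embedding P f" by blast
    next
      fix f assume f: "s k = f G" "downset_embedding P f"
      let ?t = "\<lambda>v. if v < k then f (p v) else s v"
      have pP: "p ` {..<k} = P" using p by (simp add: bij_betw_def)
      have "?t i \<le> ?t j \<longleftrightarrow> p i \<le> p j" if "i < k" "j < k" for i j
        using f(2) that pP by (auto simp: downset_embedding_def)
      moreover have "\<exists>j<k. z = ?t j" if "i < k" "z \<le> ?t i" for i z
      proof -
        have "z \<in> f ` P" using f(2) that pP by (auto simp: downset_embedding_def)
        then show ?thesis using pP by auto
      qed
      ultimately show "\<exists>t. (\<forall>v\<ge>k. t v = s v) \<and> t k = t g \<and>
        (\<forall>i<k. \<forall>j<k. t i \<le> t j \<longleftrightarrow> p i \<le> p j) \<and> (\<forall>i<k. \<forall>z\<le>t i. \<exists>j<k. z = t j)"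
        using f(1) g by (intro exI[of _ ?t]) auto
    qed
    finally show ?thesis by blast
  qed
  ultimately show ?thesis unfolding fo_definable_def by blast
qed

section \<open>Digraphs without edges and chains of isomorphism types\<close>

definition edgeless :: "nat \<Rightarrow> digraph_type" where
  "edgeless k = iso_type {..<k} {}"

definition loop_type :: digraph_type where
  "loop_type = iso_type {0::nat} {(0, 0)}"

definition edge_type :: digraph_type where
  "edge_type = iso_type {0::nat, 1} {(0, 1)}"

lemma digraph_on_loop: "digraph_on {0::nat} {(0, 0)}"
  and digraph_on_edge: "digraph_on {0::nat, 1} {(0, 1)}"
  by (auto simp: digraph_on_def)

lemma nverts_loop_type [simp]: "nverts loop_type = 1"
  and nedges_loop_type [simp]: "nedges loop_type = 1"
  unfolding loop_type_def nverts_iso_type[OF digraph_on_loop] nedges_iso_type[OF digraph_on_loop]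
  by simp_all

lemma nverts_edge_type [simp]: "nverts edge_type = 2"
  and nedges_edge_type [simp]: "nedges edge_type = 1"
  unfolding edge_type_def nverts_iso_type[OF digraph_on_edge] nedges_iso_type[OF digraph_on_edge]
  by simp_all

lemma digraph_on_edgeless: "k > 0 \<Longrightarrow> digraph_on {..<k :: nat} {}"
  by (auto simp: digraph_on_def)

lemma edgeless_le_iff: 
  assumes "k > 0" shows "edgeless k \<le> X \<longleftrightarrow> k \<le> nverts X"
proof -
  obtain V :: "nat set" and E where X: "digraph_on V E" "X = iso_type V E" by (rule ex_iso_type)
  have "(\<exists>g. inj_on g {..<k} \<and> g ` {..<k} \<subseteq> V) \<longleftrightarrow> k \<le> card V"
    using card_le_inj[of "{..<k}" V] card_inj_on_le[of _ "{..<k}" V] digraph_onD(1)[OF X(1)] by auto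
  then show ?thesis
    using X assms digraph_on_edgeless[OF assms] by (simp add: edgeless_def iso_type_le_iff)
qed

lemma nverts_edgeless [simp]: "k > 0 \<Longrightarrow> nverts (edgeless k) = k"
  and nedges_edgeless [simp]: "k > 0 \<Longrightarrow> nedges (edgeless k) = 0"
  by (simp_all add: edgeless_def digraph_on_edgeless)

lemma nverts_pos: "nverts X > 0"
proof -
  obtain V :: "nat set" and E where X: "digraph_on V E" "X = iso_type V E" by (rule ex_iso_type)
  then show ?thesis using digraph_onD(1,2)[OF X(1)] by (simp add: card_gt_0_iff)
qed

lemma edgeless_eqI: "nedges X = 0 \<Longrightarrow> X = edgeless (nverts X)"
  using edgeless_le_iff[of "nverts X" X] nverts_pos[of X]
    iso_type_eqI_card[of "edgeless (nverts X)" X] by simp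

lemma le_edgeless_iff: "k > 0 \<Longrightarrow> Y \<le> edgeless k \<longleftrightarrow> (\<exists>j\<in>{1..k}. Y = edgeless j)"
  using nedges_mono[of Y "edgeless k"] nverts_mono[of Y "edgeless k"] edgeless_eqI[of Y] nverts_pos[of Y]
  by (auto simp: edgeless_le_iff intro: bexI[of _ "nverts Y"])

lemma loop_le_iff:
  assumes "digraph_on V E" shows "loop_type \<le> iso_type V E \<longleftrightarrow> (\<exists>v. (v, v) \<in> E)"
proof -
  have "loop_type \<le> iso_type V E \<longleftrightarrow> (\<exists>g :: nat \<Rightarrow> 'a. g 0 \<in> V \<and> (g 0, g 0) \<in> E)"
    unfolding loop_type_def iso_type_le_iff[OF digraph_on_loop assms] by simp
  also have "\<dots> \<longleftrightarrow> (\<exists>v. (v, v) \<in> E)"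
    using digraph_onD(3)[OF assms] by (auto intro: exI[of _ "\<lambda>_. v" for v])
  finally show ?thesis .
qed

lemma edge_le_iff:
  assumes "digraph_on V E" shows "edge_type \<le> iso_type V E \<longleftrightarrow> (\<exists>u v. u \<noteq> v \<and> (u, v) \<in> E)"
proof -
  have "edge_type \<le> iso_type V E \<longleftrightarrow>
      (\<exists>g :: nat \<Rightarrow> 'a. g 0 \<noteq> g 1 \<and> g 0 \<in> V \<and> g 1 \<in> V \<and> (g 0, g 1) \<in> E)"
    unfolding edge_type_def iso_type_le_iff[OF digraph_on_edge assms]
    by (intro arg_cong[where f = Ex] ext) (auto simp: inj_on_def)
  also have "\<dots> \<longleftrightarrow> (\<exists>u v. u \<noteq> v \<and> (u, v) \<in> E)"
  proof
    assume "\<exists>u v. u \<noteq> v \<and> (u, v) \<in> E"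
    then obtain u v where "u \<noteq> v" "(u, v) \<in> E" by blast
    then show "\<exists>g :: nat \<Rightarrow> 'a. g 0 \<noteq> g 1 \<and> g 0 \<in> V \<and> g 1 \<in> V \<and> (g 0, g 1) \<in> E"
      using digraph_onD(3)[OF assms] by (intro exI[of _ "\<lambda>i. if i = 0 then u else v"]) auto
  qed blast
  finally show ?thesis .
qed

lemma nedges_less: "X < Y \<Longrightarrow> nverts X = nverts Y \<Longrightarrow> nedges X < nedges Y"
  using iso_type_eqI_card[of X Y] nedges_mono[of X Y] by (fastforce simp: less_le)

lemma ex_remove_edge:
  assumes "nedges X = Suc r" obtains Y where "Y < X" "nverts Y = nverts X" "nedges Y = r"
proof -
  obtain V :: "nat set" and E where X: "digraph_on V E" "X = iso_type V E" by (rule ex_iso_type)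
  then have "card E = Suc r" using assms by simp
  then obtain e where e: "e \<in> E" using card_eq_SucD by blast
  have ok: "digraph_on V (E - {e})" using X(1) by (auto simp: digraph_on_def)
  have "iso_type V (E - {e}) \<le> X"
    unfolding X(2) using X(1) digraph_onD(2,3)[OF ok] by (intro iso_type_mono) auto
  moreover have "nedges (iso_type V (E - {e})) = r" using ok e \<open>card E = _\<close> digraph_onD(4)[OF X(1)]
    by simp
  moreover have "nverts (iso_type V (E - {e})) = nverts X" using X ok by simp
  moreover have "iso_type V (E - {e}) \<noteq> X" using calculation(2) assms by auto
  ultimately show thesis by (intro that[of "iso_type V (E - {e})"]) (auto simp: less_le)
qed

text \<open>
  The two vertices without edges are incomparable to the loop, and the three vertices without
  edges are incomparable to the single edge. So a digraph with an edge can only have a chain below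
  it if it has one vertex, or two vertices and no loop. The chain below the directed cycle of
  length two has four elements, hence the bound five.
\<close>

lemma chain_edgeless:
  assumes chain: "\<And>Y Z. Y \<le> X \<Longrightarrow> Z \<le> X \<Longrightarrow> Y \<le> Z \<or> Z \<le> Y"
    and card: "card {Y. Y \<le> X} \<ge> 5"
  shows "nedges X = 0"
proof (rule ccontr)
  assume nedges: "nedges X \<noteq> 0"
  obtain V :: "nat set" and E where X: "digraph_on V E" "X = iso_type V E" by (rule ex_iso_type)
  have small: "nverts X \<le> 2"
  proof (rule ccontr)
    assume "\<not> nverts X \<le> 2"
    then have 3: "edgeless 3 \<le> X" and 2: "edgeless 2 \<le> X" by (simp_all add: edgeless_le_iff)
    from nedges X have "E \<noteq> {}" by auto
    then obtain a b where "(a, b) \<in> E" by (metis all_not_in_conv surj_pair)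
    then have "loop_type \<le> X \<or> edge_type \<le> X"
      unfolding X(2) loop_le_iff[OF X(1)] edge_le_iff[OF X(1)] by (cases "a = b") auto
    then show False
    proof
      assume "loop_type \<le> X"
      with chain 2 have "edgeless 2 \<le> loop_type \<or> loop_type \<le> edgeless 2" by blast
      then show False
        using nedges_mono[of loop_type "edgeless 2"]
        by (auto simp: edgeless_le_iff)
    next
      assume "edge_type \<le> X"
      with chain 3 have "edgeless 3 \<le> edge_type \<or> edge_type \<le> edgeless 3" by blast
      then show False
        using nedges_mono[of edge_type "edgeless 3"]
        by (auto simp: edgeless_le_iff)
    qed
  qed
  have inj: "inj_on (\<lambda>Y. nverts Y + nedges Y) {Y. Y \<le> X}"
  proof (rule inj_onI)
    fix Y Z assume YZ: "Y \<in> {Y. Y \<le> X}" "Z \<in> {Y. Y \<le> X}" "nverts Y + nedges Y = nverts Z + nedges Z"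
    have *: "A = B" if "A \<le> B" "nverts A + nedges A = nverts B + nedges B" for A B
      using that nverts_mono[OF that(1)] nedges_mono[OF that(1)] by (intro iso_type_eqI_card) auto
    show "Y = Z" using chain[of Y Z] YZ *[of Y Z] *[of Z Y] by auto
  qed
  have "nedges X \<le> 2"
  proof (cases "nverts X = 2")
    case True
    then obtain a b where V: "V = {a, b}" using X by (auto simp: card_2_iff)
    have "\<not> loop_type \<le> X"
    proof
      assume "loop_type \<le> X"
      moreover have "edgeless 2 \<le> X" using True by (simp add: edgeless_le_iff)
      ultimately have "edgeless 2 \<le> loop_type \<or> loop_type \<le> edgeless 2" using chain by blast
      then show False
        using nedges_mono[of loop_type "edgeless 2"]
        by (auto simp: edgeless_le_iff)
    qed
    then have nl: "(v, v) \<notin> E" for v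
      using loop_le_iff[OF X(1)] X(2) by blast
    have "E \<subseteq> {(a, b), (b, a)}"
    proof
      fix e assume e: "e \<in> E"
      then show "e \<in> {(a, b), (b, a)}"
        using digraph_onD(3)[OF X(1)] V nl by (cases e) auto
    qed
    then have "card E \<le> card {(a, b), (b, a)}" by (intro card_mono) auto
    also have "\<dots> \<le> 2" by (cases "a = b") simp_all
    finally show ?thesis using X by simp
  next
    case False
    then have "card V = 1" using small nverts_pos[of X] X by simp
    then obtain a where "V = {a}" by (auto simp: card_1_singleton_iff)
    then have "card E \<le> card {(a, a)}" using digraph_onD(3)[OF X(1)] by (intro card_mono) auto
    then show ?thesis using X by simp
  qed
  have "(\<lambda>Y. nverts Y + nedges Y) ` {Y. Y \<le> X} \<subseteq> {1..4}"
  proof safe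
    fix Y assume "Y \<le> X"
    then show "nverts Y + nedges Y \<in> {1..4}"
      using nverts_mono[of Y X] nedges_mono[of Y X] nverts_pos[of Y] small \<open>nedges X \<le> 2\<close> by auto
  qed
  then have "card ((\<lambda>Y. nverts Y + nedges Y) ` {Y. Y \<le> X}) \<le> 4"
    using card_mono[of "{1..4::nat}"] by fastforce
  then show False using card inj by (simp add: card_image)
qed

lemma card_edgeless_downset: "k > 0 \<Longrightarrow> card {Y. Y \<le> edgeless k} = k"
proof -
  assume k: "k > 0"
  have "{Y. Y \<le> edgeless k} = edgeless ` {1..k}"
    using le_edgeless_iff[OF k] by auto
  moreover have "inj_on edgeless {1..k}"
    by (rule inj_on_inverseI[of _ nverts]) auto
  ultimately show ?thesis by (simp add: card_image)
qed

section \<open>Numbers of vertices and edges are order invariants\<close>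

definition bounded :: "nat \<Rightarrow> digraph_type set" where
  "bounded n = {X. nverts X \<le> n}"

lemma bounded_downset: "X \<in> bounded n \<Longrightarrow> Y \<le> X \<Longrightarrow> Y \<in> bounded n"
  using nverts_mono[of Y X] by (simp add: bounded_def)

lemma finite_bounded: "finite (bounded n)"
proof -
  have "bounded n \<subseteq> case_prod iso_type ` (Pow {..<n} \<times> Pow ({..<n} \<times> {..<n}))"
  proof
    fix X assume "X \<in> bounded n"
    obtain V :: "nat set" and E where X: "digraph_on V E" "X = iso_type V E" by (rule ex_iso_type)
    with \<open>X \<in> bounded n\<close> have "card V \<le> n" "n > 0" using nverts_pos[of X]
      by (auto simp: bounded_def)
    then have ok: "digraph_on {..<n} ({..<n} \<times> {..<n})" by (auto simp: digraph_on_def)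
    obtain g where "inj_on g V" "g ` V \<subseteq> {..<n}"
      using card_le_inj[of V "{..<n}"] digraph_onD(1)[OF X(1)] \<open>card V \<le> n\<close> by auto
    then have le: "X \<le> iso_type {..<n} ({..<n} \<times> {..<n})"
      unfolding X(2) iso_type_le_iff[OF X(1) ok] using digraph_onD(3)[OF X(1)]
      by (intro exI[of _ g]) auto
    obtain V' E' where "V' \<subseteq> {..<n}" "E' \<subseteq> {..<n} \<times> {..<n}" "X = iso_type V' E'"
      by (rule le_iso_typeE[OF le ok])
    then show "X \<in> case_prod iso_type ` (Pow {..<n} \<times> Pow ({..<n} \<times> {..<n}))"
      by (intro image_eqI[of _ _ "(V', E')"]) auto
  qed
  then show ?thesis by (rule finite_subset) simp
qed

text \<open>
  These are the maps that realise the order diagram of \<open>bounded n\<close> inside the poset. That their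
  image is \<open>bounded n\<close> again is a consequence. The bound five comes from \<open>chain_edgeless\<close>.
\<close>

locale bounded_embedding =
  fixes n :: nat and f :: "digraph_type \<Rightarrow> digraph_type"
  assumes n: "5 \<le> n" and embedding: "downset_embedding (bounded n) f"
begin

lemma f_le_iff: "X \<in> bounded n \<Longrightarrow> Y \<in> bounded n \<Longrightarrow> f X \<le> f Y \<longleftrightarrow> X \<le> Y"
  using embedding by (simp add: downset_embedding_def)

lemma f_inj: "inj_on f (bounded n)"
proof (rule inj_onI)
  fix X Y assume "X \<in> bounded n" "Y \<in> bounded n" "f X = f Y"
  then show "X = Y" using f_le_iff[of X Y] f_le_iff[of Y X] by auto
qed

lemma f_mono: "X \<le> Y \<Longrightarrow> Y \<in> bounded n \<Longrightarrow> f X \<le> f Y"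
  using f_le_iff bounded_downset by blast

lemma le_fE:
  assumes "Z \<le> f X" "X \<in> bounded n"
  obtains Y where "Y \<le> X" "Z = f Y"
proof -
  obtain Y where Y: "Y \<in> bounded n" "Z = f Y"
    using embedding assms unfolding downset_embedding_def by blast
  with assms show thesis using f_le_iff that by blast
qed

lemma downset_f: "X \<in> bounded n \<Longrightarrow> {Z. Z \<le> f X} = f ` {Y. Y \<le> X}"
  using f_mono by (auto elim: le_fE)

lemma card_downset_f: "X \<in> bounded n \<Longrightarrow> card {Z. Z \<le> f X} = card {Y. Y \<le> X}"
  using card_image[OF inj_on_subset[OF f_inj], of "{Y. Y \<le> X}"] bounded_downset
  by (auto simp: downset_f)

lemma edgeless_bounded: "0 < k \<Longrightarrow> k \<le> n \<Longrightarrow> edgeless k \<in> bounded n"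
  by (simp add: bounded_def)

lemma edgeless_chain: "0 < k \<Longrightarrow> Y \<le> edgeless k \<Longrightarrow> Z \<le> edgeless k \<Longrightarrow> Y \<le> Z \<or> Z \<le> Y"
  using le_edgeless_iff[of k Y] le_edgeless_iff[of k Z] by (auto simp: edgeless_le_iff)

text \<open>
  Chains are mapped to chains of the same length.
\<close>

lemma f_edgeless:
  assumes "0 < k" "k \<le> n" shows "f (edgeless k) = edgeless k"
proof -
  have En: "edgeless n \<in> bounded n" using n by (simp add: edgeless_bounded)
  \<comment> \<open>Only for n is the chain known to be long enough; smaller digraphs without edges lie
      below it.\<close>
  have "nedges (f (edgeless n)) = 0"
  proof (rule chain_edgeless)
    fix Y Z assume "Y \<le> f (edgeless n)" "Z \<le> f (edgeless n)"
    then obtain Y' Z' where "Y = f Y'" "Z = f Z'" "Y' \<le> edgeless n" "Z' \<le> edgeless n"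
      using le_fE En by metis
    then show "Y \<le> Z \<or> Z \<le> Y"
      using edgeless_chain[of n Y' Z'] n f_mono[OF _ bounded_downset[OF En]] by auto
  next
    show "5 \<le> card {Y. Y \<le> f (edgeless n)}"
      using n by (simp add: card_downset_f[OF En] card_edgeless_downset)
  qed
  moreover have "edgeless k \<le> edgeless n" using assms by (simp add: edgeless_le_iff)
  ultimately have "nedges (f (edgeless k)) = 0"
    using nedges_mono[OF f_mono[OF _ En]] by fastforce
  then have *: "f (edgeless k) = edgeless (nverts (f (edgeless k)))" by (rule edgeless_eqI)
  have "card {Z. Z \<le> f (edgeless k)} = k"
    using assms by (simp add: card_downset_f edgeless_bounded card_edgeless_downset)
  with * show ?thesis using card_edgeless_downset[OF nverts_pos, of "f (edgeless k)"] by simp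
qed

text \<open>
  The number of vertices is the largest \<open>k\<close> with \<open>edgeless k \<le> X\<close>. The difficulty is that \<open>f X\<close> is
  not known to have at most \<open>n\<close> vertices. If it had more, then \<open>edgeless (Suc n)\<close> would be an
  image, but its preimage would have a chain of length \<open>Suc n\<close> below it.
\<close>

lemma nverts_f: assumes X: "X \<in> bounded n" shows "nverts (f X) = nverts X"
proof (rule antisym)
  have le: "k \<le> nverts (f X) \<longleftrightarrow> k \<le> nverts X" if "0 < k" "k \<le> n" for k
    using f_le_iff[OF edgeless_bounded X, OF that] that by (simp add: f_edgeless edgeless_le_iff)
  show "nverts X \<le> nverts (f X)" using X le[of "nverts X"] nverts_pos[of X]
    by (simp add: bounded_def)
  show "nverts (f X) \<le> nverts X"
  proof (rule ccontr)
    assume gr: "\<not> nverts (f X) \<le> nverts X"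
    with le[of "Suc (nverts X)"] X have "nverts X = n" by (force simp: bounded_def)
    with gr have "edgeless (Suc n) \<le> f X" by (simp add: edgeless_le_iff)
    then obtain Y where Y: "Y \<le> X" "edgeless (Suc n) = f Y" using le_fE X by blast
    then have YP: "Y \<in> bounded n" using bounded_downset X by blast
    have "nedges Y = 0"
    proof (rule chain_edgeless)
      fix A B assume AB: "A \<le> Y" "B \<le> Y"
      then have "f A \<le> edgeless (Suc n)" "f B \<le> edgeless (Suc n)"
        using f_mono YP Y(2) by simp_all
      then have "f A \<le> f B \<or> f B \<le> f A" by (intro edgeless_chain) auto
      then show "A \<le> B \<or> B \<le> A" using f_le_iff bounded_downset[OF YP] AB by blast
    next
      show "5 \<le> card {A. A \<le> Y}"
        using card_downset_f[OF YP] Y(2) card_edgeless_downset[of "Suc n"] n by simp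
    qed
    then have "Y = edgeless (nverts Y)" by (rule edgeless_eqI)
    then have "card {A. A \<le> Y} \<le> n"
      using YP card_edgeless_downset[OF nverts_pos, of Y] by (simp add: bounded_def)
    then show False
      using card_downset_f[OF YP] Y(2) card_edgeless_downset[of "Suc n"] by simp
  qed
qed

lemma f_bounded: "X \<in> bounded n \<Longrightarrow> f X \<in> bounded n"
  using nverts_f by (simp add: bounded_def)

lemma f_bij: "bij_betw f (bounded n) (bounded n)"
  using f_inj f_bounded finite_bounded by (simp add: bij_betw_def endo_inj_surj image_subset_iff)

text \<open>
  Since \<open>f\<close> permutes a finite set, the sum of \<open>\<phi>\<close> over it is the same before and after applying
  \<open>f\<close>, so none of the inequalities can be strict. This replaces all arguments about the inverse of
  \<open>f\<close>.
\<close>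

lemma invariant_if_increasing:
  fixes \<phi> :: "digraph_type \<Rightarrow> nat"
  assumes "\<And>Y. Y \<in> bounded n \<Longrightarrow> \<phi> Y \<le> \<phi> (f Y)" and X: "X \<in> bounded n"
  shows "\<phi> (f X) = \<phi> X"
proof -
  have "sum \<phi> (bounded n) = sum (\<lambda>Y. \<phi> (f Y)) (bounded n)"
    by (rule sum.reindex_bij_betw[OF f_bij, symmetric])
  from sum_mono_inv[OF this assms finite_bounded] show ?thesis by simp
qed

lemma invariant_if_preserved:
  assumes "\<And>Y. Y \<in> bounded n \<Longrightarrow> Q Y \<Longrightarrow> Q (f Y)" and X: "X \<in> bounded n"
  shows "Q (f X) \<longleftrightarrow> Q X"
proof -
  have "of_bool (Q Y) \<le> (of_bool (Q (f Y)) :: nat)" if "Y \<in> bounded n" for Y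
    using assms(1)[OF that] by simp
  then have "of_bool (Q (f X)) = (of_bool (Q X) :: nat)"
    by (rule invariant_if_increasing[where \<phi> = "\<lambda>Y. of_bool (Q Y)", OF _ X])
  then show ?thesis by (cases "Q X"; cases "Q (f X)") simp_all
qed

lemma nedges_f: assumes "X \<in> bounded n" shows "nedges (f X) = nedges X"
proof (rule invariant_if_increasing[OF _ assms])
  fix Y assume "Y \<in> bounded n"
  then show "nedges Y \<le> nedges (f Y)"
  proof (induction "nedges Y" arbitrary: Y)
    case (Suc r)
    obtain Z where Z: "Z < Y" "nverts Z = nverts Y" "nedges Z = r"
      using Suc.hyps(2)[symmetric] by (rule ex_remove_edge)
    then have ZP: "Z \<in> bounded n" using Suc.prems bounded_downset by (auto simp: less_le)
    have "f Z < f Y" using Z(1) f_le_iff[OF ZP Suc.prems] f_le_iff[OF Suc.prems ZP]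
      by (simp add: less_le_not_le)
    then have "nedges (f Z) < nedges (f Y)" using Z(2) ZP Suc.prems
      by (intro nedges_less) (simp_all add: nverts_f)
    moreover have "r \<le> nedges (f Z)" using Suc.hyps(1)[of Z] Z(3) ZP by simp
    ultimately show ?case using Suc.hyps(2) by simp
  qed simp
qed

end

lemma nsupport_le: assumes "Y \<le> X" "nedges Y = nedges X" shows "nsupport X = nsupport Y"
proof -
  obtain V :: "nat set" and E where X: "digraph_on V E" "X = iso_type V E" by (rule ex_iso_type)
  obtain V' E' where Y: "digraph_on V' E'" "E' \<subseteq> E" "Y = iso_type V' E'"
    by (rule le_iso_typeE[OF assms(1)[unfolded X(2)] X(1)])
  have "E' = E" using assms(2) X Y digraph_onD(4)[OF X(1)] by (simp add: card_subset_eq)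
  with X Y show ?thesis by simp
qed

lemma nsupport_le_nv: "nsupport X \<le> nverts X"
proof -
  obtain V :: "nat set" and E where X: "digraph_on V E" "X = iso_type V E" by (rule ex_iso_type)
  then show ?thesis using digraph_onD(1,5)[OF X(1)] by (simp add: card_mono)
qed

lemma nsupport_0: "nsupport X = 0 \<longleftrightarrow> nedges X = 0"
proof -
  obtain V :: "nat set" and E where X: "digraph_on V E" "X = iso_type V E" by (rule ex_iso_type)
  then have "finite (Field E)" using digraph_onD(4) finite_Field by blast
  then show ?thesis using X digraph_onD(4)[OF X(1)] by (auto simp: Field_def)
qed

lemma ex_remove_isolated:
  assumes "nedges X \<noteq> 0" obtains Y where "Y \<le> X" "nedges Y = nedges X" "nverts Y = nsupport X"
proof -
  obtain V :: "nat set" and E where X: "digraph_on V E" "X = iso_type V E" by (rule ex_iso_type)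
  have "E \<noteq> {}" using assms X by auto
  then have ok: "digraph_on (Field E) E"
    using digraph_onD(1,5)[OF X(1)] by (auto simp: digraph_on_def Field_def intro: finite_subset)
  have "iso_type (Field E) E \<le> X"
    unfolding X(2) using X(1) digraph_onD(2,3)[OF ok] digraph_onD(5)[OF X(1)]
    by (intro iso_type_mono) auto
  then show thesis
    using nverts_iso_type[OF ok] nedges_iso_type[OF ok]
      nedges_iso_type[OF X(1)] nsupport_iso_type[OF X(1)] X(2)
    by (intro that[of "iso_type (Field E) E"]) simp_all
qed

context bounded_embedding begin

text \<open>
  The number of vertices that are not isolated is the least number of vertices of a digraph below
  \<open>X\<close> with as many edges as \<open>X\<close>.
\<close>

lemma nsupport_f: assumes "X \<in> bounded n" shows "nsupport (f X) = nsupport X"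
proof -
  have dec: "nsupport (f Y) \<le> nsupport Y" if Y: "Y \<in> bounded n" for Y
  proof (cases "nedges Y = 0")
    case True
    then show ?thesis using nedges_f[OF Y] nsupport_0[of "f Y"] by simp
  next
    case False
    then obtain Z where Z: "Z \<le> Y" "nedges Z = nedges Y" "nverts Z = nsupport Y"
      by (rule ex_remove_isolated)
    then have ZP: "Z \<in> bounded n" using Y bounded_downset by blast
    have "nsupport (f Y) = nsupport (f Z)"
      using f_mono[OF Z(1) Y] Z(2) Y ZP by (intro nsupport_le) (simp_all add: nedges_f)
    also have "\<dots> \<le> nsupport Y" using nsupport_le_nv[of "f Z"] Z(3) ZP by (simp add: nverts_f)
    finally show ?thesis .
  qed
  have le: "nsupport Y \<le> n" if "Y \<in> bounded n" for Y
    using nsupport_le_nv[of Y] that by (simp add: bounded_def)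
  have "n - nsupport (f X) = n - nsupport X"
    by (rule invariant_if_increasing[OF _ assms]) (use dec in \<open>simp add: diff_le_mono2\<close>)
  then show ?thesis using le[OF assms] le[OF f_bounded[OF assms]] by simp
qed

end

section \<open>Orientation\<close>

text \<open>
  The digraph that decides between the two orientations, followed by those used to carry its
  orientation over to the star with two leaves.
\<close>

definition loop_out :: digraph_type where "loop_out = iso_type {0::nat, 1} {(0, 0), (0, 1)}"
definition out_star2 :: digraph_type where "out_star2 = iso_type {0::nat, 1, 2} {(0, 1), (0, 2)}"
definition loop_edge :: digraph_type where "loop_edge = iso_type {0::nat, 1, 2} {(0, 0), (1, 2)}"
definition looped_star2 :: digraph_type where
  "looped_star2 = iso_type {0::nat, 1, 2} {(0, 0), (0, 1), (0, 2)}"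

lemma digraph_on_small:
  "digraph_on {0::nat, 1} {(0, 0), (0, 1)}" "digraph_on {0::nat, 1, 2} {(0, 1), (0, 2)}"
  "digraph_on {0::nat, 1, 2} {(0, 0), (1, 2)}" "digraph_on {0::nat, 1, 2} {(0, 0), (0, 1), (0, 2)}"
  by (auto simp: digraph_on_def)

lemma nverts_small [simp]:
  "nverts loop_out = 2" "nverts out_star2 = 3" "nverts loop_edge = 3" "nverts looped_star2 = 3"
  unfolding loop_out_def out_star2_def loop_edge_def looped_star2_def digraph_on_small[THEN nverts_iso_type]
  by simp_all

lemma nedges_small [simp]:
  "nedges loop_out = 2" "nedges out_star2 = 2" "nedges loop_edge = 2" "nedges looped_star2 = 3"
  unfolding loop_out_def out_star2_def loop_edge_def looped_star2_def digraph_on_small[THEN nedges_iso_type]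
  by simp_all

lemma ex_fun2: "(\<exists>g :: nat \<Rightarrow> 'a. P (g 0) (g 1)) \<longleftrightarrow> (\<exists>x y. P x y)"
proof
  assume "\<exists>x y. P x y"
  then obtain x y where "P x y" by blast
  then show "\<exists>g :: nat \<Rightarrow> 'a. P (g 0) (g 1)"
    by (intro exI[of _ "\<lambda>i. if i = 0 then x else y"]) simp
qed blast

lemma ex_fun3: "(\<exists>g :: nat \<Rightarrow> 'a. P (g 0) (g 1) (g 2)) \<longleftrightarrow> (\<exists>x y z. P x y z)"
proof
  assume "\<exists>x y z. P x y z"
  then obtain x y z where "P x y z" by blast
  then show "\<exists>g :: nat \<Rightarrow> 'a. P (g 0) (g 1) (g 2)"
    by (intro exI[of _ "\<lambda>i. if i = 0 then x else if i = 1 then y else z"]) simp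
qed blast

lemma iso_type2_le_iff:
  assumes "digraph_on {0::nat, 1} F" "digraph_on V E"
  shows "iso_type {0::nat, 1} F \<le> iso_type V E \<longleftrightarrow>
    (\<exists>g :: nat \<Rightarrow> 'a. g 0 \<noteq> g 1 \<and> g 0 \<in> V \<and> g 1 \<in> V \<and> (\<forall>(i, j)\<in>F. (g i, g j) \<in> E))"
  unfolding iso_type_le_iff[OF assms]
  by (intro arg_cong[where f = Ex] ext) (auto simp: inj_on_def)

lemma iso_type3_le_iff:
  assumes "digraph_on {0::nat, 1, 2} F" "digraph_on V E"
  shows "iso_type {0::nat, 1, 2} F \<le> iso_type V E \<longleftrightarrow>
    (\<exists>g :: nat \<Rightarrow> 'a. distinct [g 0, g 1, g 2] \<and> g 0 \<in> V \<and> g 1 \<in> V \<and> g 2 \<in> V \<and>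
      (\<forall>(i, j)\<in>F. (g i, g j) \<in> E))"
  unfolding iso_type_le_iff[OF assms]
  by (intro arg_cong[where f = Ex] ext) (auto simp: inj_on_def)

lemma loop_out_le_iff:
  assumes "digraph_on V E"
  shows "loop_out \<le> iso_type V E \<longleftrightarrow> (\<exists>v a. v \<noteq> a \<and> (v, v) \<in> E \<and> (v, a) \<in> E)"
proof -
  have "loop_out \<le> iso_type V E \<longleftrightarrow>
    (\<exists>g :: nat \<Rightarrow> 'a. g 0 \<noteq> g 1 \<and> g 0 \<in> V \<and> g 1 \<in> V \<and> (g 0, g 0) \<in> E \<and> (g 0, g 1) \<in> E)"
    unfolding loop_out_def iso_type2_le_iff[OF digraph_on_small(1) assms] by simp
  then show ?thesis
    unfolding ex_fun2[of "\<lambda>v a. v \<noteq> a \<and> v \<in> V \<and> a \<in> V \<and> (v, v) \<in> E \<and> (v, a) \<in> E"]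
    using digraph_onD(3)[OF assms] by blast
qed

lemma loop_in_le_iff:
  assumes "digraph_on V E"
  shows "transpose_type loop_out \<le> iso_type V E \<longleftrightarrow> (\<exists>v a. v \<noteq> a \<and> (v, v) \<in> E \<and> (a, v) \<in> E)"
proof -
  have "transpose_type loop_out \<le> iso_type V E \<longleftrightarrow> loop_out \<le> iso_type V (E\<inverse>)"
    using transpose_le_iff[of "transpose_type loop_out" "iso_type V E"] transpose_iso_type[OF assms]
    by simp
  then show ?thesis using loop_out_le_iff[OF digraph_on_converse[OF assms]] by simp
qed

lemma out_star2_le_iff:
  assumes "digraph_on V E"
  shows "out_star2 \<le> iso_type V E \<longleftrightarrow> (\<exists>v a b. distinct [v, a, b] \<and> (v, a) \<in> E \<and> (v, b) \<in> E)"
proof -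
  have "out_star2 \<le> iso_type V E \<longleftrightarrow> (\<exists>g :: nat \<Rightarrow> 'a. distinct [g 0, g 1, g 2] \<and>
      g 0 \<in> V \<and> g 1 \<in> V \<and> g 2 \<in> V \<and> (g 0, g 1) \<in> E \<and> (g 0, g 2) \<in> E)"
    unfolding out_star2_def iso_type3_le_iff[OF digraph_on_small(2) assms] by simp
  then show ?thesis
    unfolding ex_fun3[of "\<lambda>v a b. distinct [v, a, b] \<and> v \<in> V \<and> a \<in> V \<and> b \<in> V \<and> (v, a) \<in> E \<and> (v, b) \<in> E"]
    using digraph_onD(3)[OF assms] by blast
qed

lemma loop_edge_le_iff:
  assumes "digraph_on V E"
  shows "loop_edge \<le> iso_type V E \<longleftrightarrow> (\<exists>v a b. distinct [v, a, b] \<and> (v, v) \<in> E \<and> (a, b) \<in> E)"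
proof -
  have "loop_edge \<le> iso_type V E \<longleftrightarrow> (\<exists>g :: nat \<Rightarrow> 'a. distinct [g 0, g 1, g 2] \<and>
      g 0 \<in> V \<and> g 1 \<in> V \<and> g 2 \<in> V \<and> (g 0, g 0) \<in> E \<and> (g 1, g 2) \<in> E)"
    unfolding loop_edge_def iso_type3_le_iff[OF digraph_on_small(3) assms] by simp
  then show ?thesis
    unfolding ex_fun3[of "\<lambda>v a b. distinct [v, a, b] \<and> v \<in> V \<and> a \<in> V \<and> b \<in> V \<and> (v, v) \<in> E \<and> (a, b) \<in> E"]
    using digraph_onD(3)[OF assms] by blast
qed

lemma looped_star2_le_iff:
  assumes "digraph_on V E"
  shows "looped_star2 \<le> iso_type V E \<longleftrightarrow>
    (\<exists>v a b. distinct [v, a, b] \<and> (v, v) \<in> E \<and> (v, a) \<in> E \<and> (v, b) \<in> E)"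
proof -
  have "looped_star2 \<le> iso_type V E \<longleftrightarrow> (\<exists>g :: nat \<Rightarrow> 'a. distinct [g 0, g 1, g 2] \<and>
      g 0 \<in> V \<and> g 1 \<in> V \<and> g 2 \<in> V \<and> (g 0, g 0) \<in> E \<and> (g 0, g 1) \<in> E \<and> (g 0, g 2) \<in> E)"
    unfolding looped_star2_def iso_type3_le_iff[OF digraph_on_small(4) assms] by simp
  then show ?thesis
    unfolding ex_fun3[of "\<lambda>v a b. distinct [v, a, b] \<and> v \<in> V \<and> a \<in> V \<and> b \<in> V \<and>
      (v, v) \<in> E \<and> (v, a) \<in> E \<and> (v, b) \<in> E"]
    using digraph_onD(3)[OF assms] by blast
qed

lemma card_2_eq: "card E = 2 \<Longrightarrow> x \<in> E \<Longrightarrow> y \<in> E \<Longrightarrow> x \<noteq> y \<Longrightarrow> E = {x, y}"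
  by (auto simp: card_2_iff)

lemma loop_type_eqI: assumes "nverts X = 1" "nedges X = 1" shows "X = loop_type"
proof -
  obtain V :: "nat set" and E where X: "digraph_on V E" "X = iso_type V E" by (rule ex_iso_type)
  obtain v where "V = {v}" using assms X by (auto simp: card_1_singleton_iff)
  moreover obtain e where "E = {e}" using assms X by (auto simp: card_1_singleton_iff)
  ultimately have "(v, v) \<in> E" using digraph_onD(3)[OF X(1)] by auto
  then have "loop_type \<le> X" using X loop_le_iff by blast
  with assms show ?thesis using iso_type_eqI_card[of loop_type X] by simp
qed

lemma edge_type_eqI: assumes "nverts X = 2" "nedges X = 1" "\<not> loop_type \<le> X" shows "X = edge_type"
proof -
  obtain V :: "nat set" and E where X: "digraph_on V E" "X = iso_type V E" by (rule ex_iso_type)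
  obtain u v where "E = {(u, v)}" using assms X by (auto simp: card_1_singleton_iff)
  moreover from this have "u \<noteq> v" using assms(3) X loop_le_iff by blast
  ultimately have "edge_type \<le> X" using X edge_le_iff by blast
  with assms show ?thesis using iso_type_eqI_card[of edge_type X] by simp
qed

lemma loop_out_cases:
  assumes "nverts X = 2" "nedges X = 2" "loop_type \<le> X" "edge_type \<le> X"
  shows "X = loop_out \<or> X = transpose_type loop_out"
proof -
  obtain V :: "nat set" and E where X: "digraph_on V E" "X = iso_type V E" by (rule ex_iso_type)
  obtain v where v: "(v, v) \<in> E" using assms X loop_le_iff by blast
  obtain x y where xy: "x \<noteq> y" "(x, y) \<in> E" using assms X edge_le_iff by blast
  have "v \<in> V" "x \<in> V" "y \<in> V" using digraph_onD(3)[OF X(1)] v xy by auto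
  moreover have "card V = 2" using assms X by simp
  ultimately have "v = x \<or> v = y" using xy by (auto simp: card_2_iff)
  then have "loop_out \<le> X \<or> transpose_type loop_out \<le> X"
  proof
    assume "v = x"
    then have "loop_out \<le> X"
      unfolding X(2) loop_out_le_iff[OF X(1)] using v xy by (intro exI[of _ x] exI[of _ y]) simp
    then show ?thesis ..
  next
    assume "v = y"
    then have "transpose_type loop_out \<le> X"
      unfolding X(2) loop_in_le_iff[OF X(1)] using v xy by (intro exI[of _ y] exI[of _ x]) simp
    then show ?thesis ..
  qed
  then show ?thesis
    using assms(1,2) iso_type_eqI_card[of loop_out X]
      iso_type_eqI_card[of "transpose_type loop_out" X] by auto
qed

lemma loop_edge_eqI:
  assumes "nverts X = 3" "nedges X = 2" "nsupport X = 3" "loop_type \<le> X" "edge_type \<le> X"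
  shows "X = loop_edge"
proof -
  obtain V :: "nat set" and E where X: "digraph_on V E" "X = iso_type V E" by (rule ex_iso_type)
  obtain v where v: "(v, v) \<in> E" using assms X loop_le_iff by blast
  obtain x y where xy: "x \<noteq> y" "(x, y) \<in> E" using assms X edge_le_iff by blast
  have "E = {(v, v), (x, y)}" using v xy assms X by (intro card_2_eq) auto
  then have "Field E = {v, x, y}" by (auto simp: Field_def)
  then have "card {v, x, y} = 3" using assms X by simp
  then have "distinct [v, x, y]" by (auto simp: card_insert_if split: if_splits)
  then have "loop_edge \<le> X" unfolding X(2) loop_edge_le_iff[OF X(1)] using v xy by metis
  with assms show ?thesis using iso_type_eqI_card[of loop_edge X] by simp
qed

text \<open>
  On three vertices, a third edge next to a loop and an edge leaving it creates an edge entering a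
  loop or an edge disjoint from a loop, except when it leaves the loop as well.
\<close>

lemma looped_star2_eqI:
  assumes "nverts X = 3"
    "nedges X = 3" "loop_out \<le> X" "\<not> transpose_type loop_out \<le> X" "\<not> loop_edge \<le> X"
  shows "X = looped_star2"
proof -
  obtain V :: "nat set" and E where X: "digraph_on V E" "X = iso_type V E" by (rule ex_iso_type)
  obtain v a where va: "v \<noteq> a" "(v, v) \<in> E" "(v, a) \<in> E"
    using assms(3)[unfolded X(2) loop_out_le_iff[OF X(1)]] by blast
  have no_in: "(x, v') \<notin> E" if "(v', v') \<in> E" "x \<noteq> v'" for x v'
    using assms(4)[unfolded X(2) loop_in_le_iff[OF X(1)]] that by metis
  have no_edge: "(x, y) \<notin> E" if "(v', v') \<in> E" "distinct [v', x, y]" for x y v'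
    using assms(5)[unfolded X(2) loop_edge_le_iff[OF X(1)]] that by metis
  have "\<not> E \<subseteq> {(v, v), (v, a)}"
  proof
    assume "E \<subseteq> {(v, v), (v, a)}"
    then have "card E \<le> card {(v, v), (v, a)}" by (rule card_mono[rotated]) simp
    then show False using assms(2) X va(1) by simp
  qed
  then obtain x y where xy: "(x, y) \<in> E" "(x, y) \<noteq> (v, v)" "(x, y) \<noteq> (v, a)" by auto
  have "x = v"
  proof (rule ccontr)
    assume "x \<noteq> v"
    then have "y \<noteq> v" using no_in va xy by blast
    show False
    proof (cases "x = y")
      case True
      then show False
        using xy va no_in[of x v] no_edge[of x v a] \<open>x \<noteq> v\<close> by (cases "x = a") auto
    next
      case False
      then show False using no_edge[of v x y] va xy \<open>x \<noteq> v\<close> \<open>y \<noteq> v\<close> by auto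
    qed
  qed
  then have "distinct [v, a, y]" using xy va by auto
  then have "looped_star2 \<le> X" unfolding X(2) looped_star2_le_iff[OF X(1)] using va xy \<open>x = v\<close>
    by metis
  with assms show ?thesis using iso_type_eqI_card[of looped_star2 X] by simp
qed

lemma out_star2_eqI:
  assumes "X \<le> looped_star2" "nedges X = 2" "nverts X = 3" "\<not> loop_type \<le> X"
  shows "X = out_star2"
proof -
  obtain V E where X: "digraph_on V E" "E \<subseteq> {(0::nat, 0), (0, 1), (0, 2)}" "X = iso_type V E"
    by (rule le_iso_typeE[OF assms(1)[unfolded looped_star2_def] digraph_on_small(4)])
  have "(0, 0) \<notin> E" using assms(4) X loop_le_iff by blast
  then have "E \<subseteq> {(0, 1), (0, 2)}" using X(2) by auto
  moreover have "card E = 2" using assms X by simp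
  ultimately have "E = {(0, 1), (0, 2)}" by (intro card_subset_eq) auto
  then have "out_star2 \<le> X"
    unfolding X(3) out_star2_le_iff[OF X(1)] by (intro exI[of _ 0] exI[of _ 1] exI[of _ 2]) simp
  with assms show ?thesis using iso_type_eqI_card[of out_star2 X] by simp
qed

lemma out_star2_facts: "out_star2 \<le> looped_star2" "\<not> loop_type \<le> out_star2"
proof -
  show "out_star2 \<le> looped_star2"
    unfolding looped_star2_def out_star2_le_iff[OF digraph_on_small(4)]
    by (intro exI[of _ 0] exI[of _ 1] exI[of _ 2]) simp
  show "\<not> loop_type \<le> out_star2"
    unfolding out_star2_def loop_le_iff[OF digraph_on_small(2)] by auto
qed

lemma looped_star2_facts:
  "loop_out \<le> looped_star2" "\<not> transpose_type loop_out \<le> looped_star2" "\<not> loop_edge \<le> looped_star2"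
  unfolding looped_star2_def loop_out_le_iff[OF digraph_on_small(4)] loop_in_le_iff[OF digraph_on_small(4)]
    loop_edge_le_iff[OF digraph_on_small(4)]
  by (intro exI[of _ 0] exI[of _ 1]) auto

lemma loop_edge_facts: "nsupport loop_edge = 3" "loop_type \<le> loop_edge" "edge_type \<le> loop_edge"
proof -
  have "Field {(0::nat, 0::nat), (1, 2)} = {0, 1, 2}" by (auto simp: Field_def)
  then show "nsupport loop_edge = 3"
    unfolding loop_edge_def nsupport_iso_type[OF digraph_on_small(3)] by simp
  show "loop_type \<le> loop_edge"
    unfolding loop_edge_def loop_le_iff[OF digraph_on_small(3)] by blast
  show "edge_type \<le> loop_edge"
    unfolding loop_edge_def edge_le_iff[OF digraph_on_small(3)]
    by (intro exI[of _ 1] exI[of _ 2]) simp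
qed

lemma loop_out_facts: "loop_type \<le> loop_out" "edge_type \<le> loop_out"
proof -
  show "loop_type \<le> loop_out"
    unfolding loop_out_def loop_le_iff[OF digraph_on_small(1)] by blast
  show "edge_type \<le> loop_out"
    unfolding loop_out_def edge_le_iff[OF digraph_on_small(1)]
    by (intro exI[of _ 0] exI[of _ 1]) simp
qed

context bounded_embedding begin

lemma small_bounded: "nverts X \<le> 5 \<Longrightarrow> X \<in> bounded n"
  using n by (simp add: bounded_def)

lemma f_loop: "f loop_type = loop_type"
  by (intro loop_type_eqI) (simp_all add: nverts_f nedges_f small_bounded)

lemma loop_le_f: "X \<in> bounded n \<Longrightarrow> loop_type \<le> f X \<longleftrightarrow> loop_type \<le> X"
  using f_le_iff[of loop_type X] by (simp add: f_loop small_bounded)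

lemma f_edge: "f edge_type = edge_type"
proof (intro edge_type_eqI)
  have "\<not> loop_type \<le> edge_type" using nverts_mono[of loop_type edge_type]
    unfolding edge_type_def loop_le_iff[OF digraph_on_edge] by simp
  then show "\<not> loop_type \<le> f edge_type" by (simp add: loop_le_f small_bounded)
qed (simp_all add: nverts_f nedges_f small_bounded)

lemma edge_le_f: "X \<in> bounded n \<Longrightarrow> edge_type \<le> f X \<longleftrightarrow> edge_type \<le> X"
  using f_le_iff[of edge_type X] by (simp add: f_edge small_bounded)

lemma f_loop_out_cases: "f loop_out = loop_out \<or> f loop_out = transpose_type loop_out"
  by (intro loop_out_cases) (simp_all add: nverts_f nedges_f loop_le_f edge_le_f small_bounded loop_out_facts)

lemma f_loop_edge: "f loop_edge = loop_edge"
  by (intro loop_edge_eqI)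
    (simp_all add: nverts_f nedges_f nsupport_f loop_le_f edge_le_f small_bounded loop_edge_facts)

end

text \<open>
  The other case reduces to this one by composing \<open>f\<close> with the transposition.
\<close>

locale oriented_embedding = bounded_embedding +
  assumes f_loop_out: "f loop_out = loop_out"
begin

lemma f_loop_in: "f (transpose_type loop_out) = transpose_type loop_out"
proof -
  have "loop_type \<le> transpose_type loop_out" "edge_type \<le> transpose_type loop_out"
    using digraph_on_converse[OF digraph_on_small(1)]
    unfolding loop_out_def transpose_iso_type[OF digraph_on_small(1)] 
    by (auto simp: loop_le_iff edge_le_iff)
  then have "f (transpose_type loop_out) = loop_out \<or> f (transpose_type loop_out) = transpose_type loop_out"
    by (intro loop_out_cases) (simp_all add: nverts_f nedges_f loop_le_f edge_le_f small_bounded)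
  then show ?thesis
    using inj_onD[OF f_inj, of "transpose_type loop_out" loop_out] f_loop_out
    by (auto simp: small_bounded)
qed

lemma f_looped_star2: "f looped_star2 = looped_star2"
proof (intro looped_star2_eqI)
  show "loop_out \<le> f looped_star2"
    using f_le_iff[of loop_out looped_star2] looped_star2_facts
    by (simp add: f_loop_out small_bounded)
  show "\<not> transpose_type loop_out \<le> f looped_star2"
    using f_le_iff[of "transpose_type loop_out" looped_star2] looped_star2_facts
    by (simp add: f_loop_in small_bounded)
  show "\<not> loop_edge \<le> f looped_star2"
    using f_le_iff[of loop_edge looped_star2] looped_star2_facts
    by (simp add: f_loop_edge small_bounded)
qed (simp_all add: nverts_f nedges_f small_bounded)

lemma f_out_star2: "f out_star2 = out_star2"
proof (intro out_star2_eqI)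
  show "f out_star2 \<le> looped_star2"
    using f_mono[OF out_star2_facts(1)] by (simp add: f_looped_star2 small_bounded)
qed (simp_all add: nverts_f nedges_f loop_le_f small_bounded out_star2_facts)

end

section \<open>Out-degree sequences\<close>

text \<open>
  Up to isolated vertices, \<open>loop_out\<close> and \<open>out_star2\<close> are the two digraphs with two edges that
  have a common tail.
\<close>

definition one_tail :: "digraph_type \<Rightarrow> bool" where
  "one_tail X \<longleftrightarrow> (\<forall>Y\<le>X. nedges Y = 2 \<longrightarrow> loop_out \<le> Y \<or> out_star2 \<le> Y)"

definition outdeg_le :: "nat \<Rightarrow> digraph_type \<Rightarrow> bool" where
  "outdeg_le t X \<longleftrightarrow> (\<forall>Y\<le>X. one_tail Y \<longrightarrow> nedges Y \<le> t)"

lemma same_tail_iff: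
  assumes "digraph_on V {(u, a), (v, b)}" "(u, a) \<noteq> (v, b)"
  shows "loop_out \<le> iso_type V {(u, a), (v, b)} \<or> out_star2 \<le> iso_type V {(u, a), (v, b)} \<longleftrightarrow> u = v"
proof
  assume "loop_out \<le> iso_type V {(u, a), (v, b)} \<or> out_star2 \<le> iso_type V {(u, a), (v, b)}"
  then show "u = v"
    unfolding loop_out_le_iff[OF assms(1)] out_star2_le_iff[OF assms(1)] by auto
next
  assume "u = v"
  with assms(2) have ab: "a \<noteq> b" by simp
  show "loop_out \<le> iso_type V {(u, a), (v, b)} \<or> out_star2 \<le> iso_type V {(u, a), (v, b)}"
  proof (cases "a = u \<or> b = u")
    case True
    then have "loop_out \<le> iso_type V {(u, a), (v, b)}"
      unfolding loop_out_le_iff[OF assms(1)] using ab \<open>u = v\<close>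
      by (intro exI[of _ u] exI[of _ "if a = u then b else a"]) auto
    then show ?thesis ..
  next
    case False
    then have "out_star2 \<le> iso_type V {(u, a), (v, b)}"
      unfolding out_star2_le_iff[OF assms(1)] using ab \<open>u = v\<close>
      by (intro exI[of _ u] exI[of _ a] exI[of _ b]) auto
    then show ?thesis ..
  qed
qed

lemma one_tail_iff:
  assumes "digraph_on V E"
  shows "one_tail (iso_type V E) \<longleftrightarrow> (\<forall>e\<in>E. \<forall>e'\<in>E. fst e = fst e')"
proof
  assume L: "one_tail (iso_type V E)"
  show "\<forall>e\<in>E. \<forall>e'\<in>E. fst e = fst e'"
  proof (intro ballI)
    fix e e' assume e: "e \<in> E" "e' \<in> E"
    obtain u a v b where uv: "e = (u, a)" "e' = (v, b)" by (cases e, cases e')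
    show "fst e = fst e'"
    proof (cases "e = e'")
      case False
      have ok: "digraph_on V {(u, a), (v, b)}" using assms e uv by (auto simp: digraph_on_def)
      have le: "iso_type V {(u, a), (v, b)} \<le> iso_type V E"
        using assms e uv digraph_onD(2,3)[OF ok] by (intro iso_type_mono) auto
      have "nedges (iso_type V {(u, a), (v, b)}) = 2" using False uv nedges_iso_type[OF ok] by simp
      with L le have "loop_out \<le> iso_type V {(u, a), (v, b)} \<or> out_star2 \<le> iso_type V {(u, a), (v, b)}"
        unfolding one_tail_def by blast
      then show ?thesis using same_tail_iff[OF ok] False uv by simp
    qed simp
  qed
next
  assume R: "\<forall>e\<in>E. \<forall>e'\<in>E. fst e = fst e'"
  show "one_tail (iso_type V E)"
    unfolding one_tail_def
  proof (intro allI impI)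
    fix Y assume Y: "Y \<le> iso_type V E" "nedges Y = 2"
    obtain V' E' where Y': "digraph_on V' E'" "E' \<subseteq> E" "Y = iso_type V' E'"
      by (rule le_iso_typeE[OF Y(1) assms])
    then have "card E' = 2" using Y by simp
    then obtain e e' where e: "E' = {e, e'}" "e \<noteq> e'" by (auto simp: card_2_iff)
    obtain u a v b where uv: "e = (u, a)" "e' = (v, b)" by (cases e, cases e')
    have "e \<in> E" "e' \<in> E" using Y'(2) e(1) by auto
    then have "fst e = fst e'" using R by blast
    then have "u = v" using uv by simp
    then show "loop_out \<le> Y \<or> out_star2 \<le> Y"
      using same_tail_iff[of V' u a v b] Y' e uv by simp
  qed
qed

lemma outdeg_le_iff:
  assumes "digraph_on V E"
  shows "outdeg_le t (iso_type V E) \<longleftrightarrow> (\<forall>v. outdeg E v \<le> t)"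
proof
  assume L: "outdeg_le t (iso_type V E)"
  show "\<forall>v. outdeg E v \<le> t"
  proof
    fix v
    let ?F = "{v} \<times> E `` {v}"
    have sub: "?F \<subseteq> E" by auto
    then have ok: "digraph_on V ?F" using assms by (auto simp: digraph_on_def)
    have "iso_type V ?F \<le> iso_type V E"
      using assms digraph_onD(2,3)[OF ok] sub by (intro iso_type_mono) auto
    moreover have "one_tail (iso_type V ?F)" unfolding one_tail_iff[OF ok] by auto
    ultimately have "nedges (iso_type V ?F) \<le> t" using L unfolding outdeg_le_def by blast
    then show "outdeg E v \<le> t" using nedges_iso_type[OF ok] by (simp add: card_cartesian_product)
  qed
next
  assume R: "\<forall>v. outdeg E v \<le> t"
  show "outdeg_le t (iso_type V E)"
    unfolding outdeg_le_def
  proof (intro allI impI)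
    fix Y assume Y: "Y \<le> iso_type V E" "one_tail Y"
    obtain V' E' where Y': "digraph_on V' E'" "E' \<subseteq> E" "Y = iso_type V' E'"
      by (rule le_iso_typeE[OF Y(1) assms])
    have one: "\<forall>e\<in>E'. \<forall>e'\<in>E'. fst e = fst e'"
      using Y(2) unfolding Y'(3) one_tail_iff[OF Y'(1)] .
    show "nedges Y \<le> t"
    proof (cases "E' = {}")
      case False
      then obtain e where "e \<in> E'" by blast
      have "E' \<subseteq> {fst e} \<times> E `` {fst e}"
      proof
        fix x assume x: "x \<in> E'"
        then have "fst x = fst e" "x \<in> E" using one \<open>e \<in> E'\<close> Y'(2) by blast+
        then show "x \<in> {fst e} \<times> E `` {fst e}" by (cases x) simp
      qed
      moreover have "finite (E `` {fst e})" using digraph_onD(4)[OF assms] by (rule finite_Image)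
      ultimately have "card E' \<le> card ({fst e} \<times> E `` {fst e})" by (intro card_mono) auto
      also have "\<dots> \<le> t" using R by (simp add: card_cartesian_product)
      finally show ?thesis using Y' by simp
    qed (use Y' in simp)
  qed
qed

lemma outdeg_mono: "finite E \<Longrightarrow> F \<subseteq> E \<Longrightarrow> outdeg F v \<le> outdeg E v"
  by (intro card_mono finite_Image) auto

lemma card_eq_sum_outdeg:
  assumes "finite V" "E \<subseteq> V \<times> V"
  shows "card E = (\<Sum>v\<in>V. outdeg E v)"
proof -
  have "E = (SIGMA v:V. E `` {v})" using assms(2) by auto
  then have "card E = card (SIGMA v:V. E `` {v})" by simp
  also have "\<dots> = (\<Sum>v\<in>V. outdeg E v)"
    using assms finite_subset[OF assms(2)] by (intro card_SigmaI) (auto intro: finite_Image)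
  finally show ?thesis .
qed

lemma nedges_le_outdeg_sum:
  assumes "Y \<le> X" "outdeg_le t Y" shows "nedges Y \<le> outdeg_sum t X"
proof -
  obtain V :: "nat set" and E where X: "digraph_on V E" "X = iso_type V E" by (rule ex_iso_type)
  obtain V' E' where Y: "digraph_on V' E'" "V' \<subseteq> V" "E' \<subseteq> E" "Y = iso_type V' E'"
    by (rule le_iso_typeE[OF assms(1)[unfolded X(2)] X(1)])
  have d: "outdeg E' v \<le> t" for v using assms(2) unfolding Y(4) outdeg_le_iff[OF Y(1)] by blast
  have "card E' = (\<Sum>v\<in>V. outdeg E' v)"
    using digraph_onD(1)[OF X(1)] digraph_onD(3)[OF Y(1)] Y(2) by (intro card_eq_sum_outdeg) auto
  also have "\<dots> \<le> (\<Sum>v\<in>V. min (outdeg E v) t)"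
    using d outdeg_mono[OF digraph_onD(4)[OF X(1)] Y(3)] by (intro sum_mono) simp
  finally show ?thesis using X Y by simp
qed

lemma ex_outdeg_le:
  obtains Y where "Y \<le> X" "outdeg_le t Y" "nedges Y = outdeg_sum t X"
proof -
  obtain V :: "nat set" and E where X: "digraph_on V E" "X = iso_type V E" by (rule ex_iso_type)
  have "\<exists>A. A \<subseteq> E `` {v} \<and> card A = min (outdeg E v) t" for v
    by (meson min.cobounded1 obtain_subset_with_card_n)
  then obtain A where A: "A v \<subseteq> E `` {v}" "card (A v) = min (outdeg E v) t" for v by metis
  let ?F = "SIGMA v:V. A v"
  have sub: "?F \<subseteq> E" using A(1) by blast
  then have ok: "digraph_on V ?F" using X(1) by (auto simp: digraph_on_def)
  have FA: "?F `` {v} = (if v \<in> V then A v else {})" for v by auto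
  have "iso_type V ?F \<le> X"
    unfolding X(2) using X(1) digraph_onD(2,3)[OF ok] sub by (intro iso_type_mono) auto
  moreover have "outdeg_le t (iso_type V ?F)"
    unfolding outdeg_le_iff[OF ok] FA using A(2) by simp
  moreover have "nedges (iso_type V ?F) = outdeg_sum t X"
    unfolding X(2) nedges_iso_type[OF ok] outdeg_sum_iso_type[OF X(1)]
      card_eq_sum_outdeg[OF digraph_onD(1)[OF X(1)] digraph_onD(3)[OF ok]] FA
    using A(2) by (intro sum.cong) auto
  ultimately show thesis by (rule that)
qed

context oriented_embedding begin

lemma one_tail_f: "X \<in> bounded n \<Longrightarrow> one_tail (f X) \<longleftrightarrow> one_tail X"
proof (rule invariant_if_preserved)
  fix X assume X: "X \<in> bounded n" "one_tail X"
  show "one_tail (f X)"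
    unfolding one_tail_def
  proof (intro allI impI)
    fix Z assume Z: "Z \<le> f X" "nedges Z = 2"
    obtain Y where Y: "Y \<le> X" "Z = f Y" by (rule le_fE[OF Z(1) X(1)])
    then have YP: "Y \<in> bounded n" using X(1) bounded_downset by blast
    then have "nedges Y = 2" using Z(2) Y(2) nedges_f by simp
    then have "loop_out \<le> Y \<or> out_star2 \<le> Y" using X(2) Y(1) by (simp add: one_tail_def)
    then show "loop_out \<le> Z \<or> out_star2 \<le> Z"
      using f_mono[OF _ YP, of loop_out] f_mono[OF _ YP, of out_star2]
      by (auto simp: f_loop_out f_out_star2 Y(2))
  qed
qed

lemma outdeg_le_f: "X \<in> bounded n \<Longrightarrow> outdeg_le t (f X) \<longleftrightarrow> outdeg_le t X"
proof (rule invariant_if_preserved)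
  fix X assume X: "X \<in> bounded n" "outdeg_le t X"
  show "outdeg_le t (f X)"
    unfolding outdeg_le_def
  proof (intro allI impI)
    fix Z assume Z: "Z \<le> f X" "one_tail Z"
    obtain Y where Y: "Y \<le> X" "Z = f Y" by (rule le_fE[OF Z(1) X(1)])
    then have YP: "Y \<in> bounded n" using X(1) bounded_downset by blast
    then show "nedges Z \<le> t" using Z(2) X(2) Y by (simp add: one_tail_f nedges_f outdeg_le_def)
  qed
qed

text \<open>
  It is the largest number of edges of a digraph below \<open>X\<close> all of whose out-degrees are at most
  \<open>t\<close>.
\<close>

lemma outdeg_sum_f: assumes "X \<in> bounded n" shows "outdeg_sum t (f X) = outdeg_sum t X"
proof (rule invariant_if_increasing[OF _ assms])
  fix X assume X: "X \<in> bounded n"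
  obtain Y where Y: "Y \<le> X" "outdeg_le t Y" "nedges Y = outdeg_sum t X" by (rule ex_outdeg_le)
  then have YP: "Y \<in> bounded n" using X bounded_downset by blast
  have "nedges (f Y) \<le> outdeg_sum t (f X)"
    using f_mono[OF Y(1) X] Y(2) YP by (intro nedges_le_outdeg_sum) (simp_all add: outdeg_le_f)
  then show "outdeg_sum t X \<le> outdeg_sum t (f X)" using Y(3) YP nedges_f by simp
qed

end

lemma transpose_bounded: "transpose_type X \<in> bounded n \<longleftrightarrow> X \<in> bounded n"
  by (simp add: bounded_def)

lemma le_transpose_iff: "X \<le> transpose_type Y \<longleftrightarrow> transpose_type X \<le> Y"
  using transpose_le_iff[of "transpose_type X" Y] by simp

lemma (in bounded_embedding) transpose_f: "bounded_embedding n (\<lambda>X. transpose_type (f X))"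
proof
  show "downset_embedding (bounded n) (\<lambda>X. transpose_type (f X))"
    unfolding downset_embedding_def
  proof (intro conjI ballI allI impI)
    fix X Z assume X: "X \<in> bounded n" and "Z \<le> transpose_type (f X)"
    then have "transpose_type Z \<le> f X" by (simp add: le_transpose_iff)
    then obtain Y where "Y \<le> X" "transpose_type Z = f Y" by (rule le_fE[OF _ X])
    then show "Z \<in> (\<lambda>X. transpose_type (f X)) ` bounded n"
      using X bounded_downset by (metis imageI transpose_transpose)
  qed (simp add: f_le_iff)
qed (rule n)

lemma (in bounded_embedding) f_transpose: "bounded_embedding n (\<lambda>X. f (transpose_type X))"
proof
  show "downset_embedding (bounded n) (\<lambda>X. f (transpose_type X))"
    unfolding downset_embedding_def
  proof (intro conjI ballI allI impI)
    fix X Z assume X: "X \<in> bounded n" and "Z \<le> f (transpose_type X)"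
    then obtain Y where Y: "Y \<le> transpose_type X" "Z = f Y"
      using transpose_bounded by (metis le_fE)
    have "transpose_type Y \<in> bounded n"
      using Y(1) X bounded_downset transpose_bounded by blast
    with Y(2) show "Z \<in> (\<lambda>X. f (transpose_type X)) ` bounded n"
      by (metis (no_types, lifting) imageI transpose_transpose)
  qed (simp add: f_le_iff transpose_bounded)
qed (rule n)

text \<open>
  Conjugating \<open>f\<close> by the transposition transfers what is known about out-degrees to in-degrees.
\<close>

lemma (in oriented_embedding) conj_transpose:
  "oriented_embedding n (\<lambda>X. transpose_type (f (transpose_type X)))"
proof -
  interpret ft: bounded_embedding n "\<lambda>X. f (transpose_type X)" by (rule f_transpose)
  interpret tft: bounded_embedding n "\<lambda>X. transpose_type (f (transpose_type X))"
    by (rule ft.transpose_f)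
  show ?thesis by unfold_locales (simp add: f_loop_in)
qed

lemma (in oriented_embedding) indeg_sum_f:
  assumes "X \<in> bounded n"
  shows "outdeg_sum t (transpose_type (f X)) = outdeg_sum t (transpose_type X)"
proof -
  interpret c: oriented_embedding n "\<lambda>X. transpose_type (f (transpose_type X))"
    by (rule conj_transpose)
  from c.outdeg_sum_f[of "transpose_type X"] assms show ?thesis by (simp add: transpose_bounded)
qed

section \<open>Removing pendant vertices\<close>

lemma outdeg_Un_disjoint:
  assumes "finite A" "finite B" "A \<inter> B = {}"
  shows "outdeg (A \<union> B) v = outdeg A v + outdeg B v"
proof -
  have "(A \<union> B) `` {v} = A `` {v} \<union> B `` {v}" by auto
  moreover have "A `` {v} \<inter> B `` {v} = {}" using assms(3) by auto
  ultimately show ?thesis using assms(1,2) by (simp add: card_Un_disjoint finite_Image)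
qed

lemma outdeg_single_tail: "outdeg ({s} \<times> A) v = (if v = s then card A else 0)"
proof -
  have "({s} \<times> A) `` {v} = (if v = s then A else {})" by auto
  then show ?thesis by simp
qed

lemma outdeg_le_card:
  assumes "finite E" shows "outdeg E v \<le> card E"
proof -
  have "E `` {v} \<subseteq> snd ` E" by (force simp: image_iff)
  then have "card (E `` {v}) \<le> card (snd ` E)" using assms by (intro card_mono) auto
  also have "\<dots> \<le> card E" using assms by (rule card_image_le)
  finally show ?thesis .
qed

lemma sum_outdeg_extend:
  assumes "finite W" "V \<subseteq> W" "E \<subseteq> V \<times> V"
  shows "(\<Sum>v\<in>V. min (outdeg E v) t) = (\<Sum>v\<in>W. min (outdeg E v) t)"
proof (rule sum.mono_neutral_left[OF assms(1,2)], rule ballI)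
  fix v assume "v \<in> W - V"
  then have "E `` {v} = {}" using assms(3) by auto
  then show "min (outdeg E v) t = 0" by simp
qed

lemma (in oriented_embedding) outdeg_sum_eq:
  assumes "digraph_on V E" "digraph_on V' E'" "f (iso_type V E) = iso_type V' E'" "card V \<le> n"
  shows "(\<Sum>v\<in>V'. min (outdeg E' v) t) = (\<Sum>v\<in>V. min (outdeg E v) t)"
  using outdeg_sum_f[of "iso_type V E" t] assms outdeg_sum_iso_type[OF assms(1)]
    outdeg_sum_iso_type[OF assms(2)]
  by (simp add: bounded_def)

lemma (in oriented_embedding) indeg_sum_eq:
  assumes "digraph_on V E" "digraph_on V' E'" "f (iso_type V E) = iso_type V' E'" "card V \<le> n"
  shows "(\<Sum>v\<in>V'. min (outdeg (E'\<inverse>) v) t) = (\<Sum>v\<in>V. min (outdeg (E\<inverse>) v) t)"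
  using indeg_sum_f[of "iso_type V E" t] assms
    outdeg_sum_iso_type[OF digraph_on_converse[OF assms(1)]]
      outdeg_sum_iso_type[OF digraph_on_converse[OF assms(2)]]
  by (simp add: bounded_def)

lemma (in bounded_embedding) card_eqs:
  assumes "digraph_on V E" "digraph_on V' E'" "f (iso_type V E) = iso_type V' E'" "card V \<le> n"
  shows "card V' = card V" "card E' = card E" "card (Field E') = card (Field E)"
  using nverts_f[of "iso_type V E"] nedges_f[of "iso_type V E"] nsupport_f[of "iso_type V E"] assms
    nsupport_iso_type[OF assms(1)] nsupport_iso_type[OF assms(2)]
  by (simp_all add: bounded_def)

text \<open>
  Let \<open>d\<close> be the out-degree of \<open>s\<close>. The image of \<open>(V, E)\<close> arises from \<open>(V, E)\<close> by replacing a set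
  \<open>M\<close> of \<open>q\<close> edges by \<open>q\<close> of the pendants at \<open>s\<close>. By the gap condition, cutting off the
  out-degrees at \<open>d\<close> shows that no vertex of out-degree at most \<open>d\<close>, other than \<open>s\<close>, is the tail
  of an edge in \<open>M\<close>, and cutting off at \<open>d + card Q\<close> makes the vertices of high out-degree
  invisible and shows that \<open>s\<close> has kept its out-degree. So all edges in \<open>M\<close> leave \<open>s\<close>. The number
  of vertices that are not isolated then shows that the heads of the edges in \<open>M\<close> are pendants of
  \<open>s\<close>, so that the replacement has not changed the isomorphism type.
\<close>

lemma (in oriented_embedding) strip_pendants:
  fixes V :: "'a set"
  assumes ok: "digraph_on V E" and s: "s \<in> V" and Q: "finite Q" "Q \<inter> V = {}" "card (V \<union> Q) \<le> n"
    and Z_fixed: "f (iso_type (V \<union> Q) (E \<union> {s} \<times> Q)) = iso_type (V \<union> Q) (E \<union> {s} \<times> Q)"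
    and gap: "\<And>v. v \<in> V \<Longrightarrow> outdeg E v \<le> outdeg E s \<or> outdeg E s + 2 * card Q \<le> outdeg E v"
  shows "f (iso_type V E) = iso_type V E"
proof -
  let ?W = "V \<union> Q" and ?G = "E \<union> {s} \<times> Q" and ?d = "outdeg E s"
  note V = digraph_onD(1)[OF ok] and EV = digraph_onD(3)[OF ok] and E = digraph_onD(4)[OF ok]
  have okW: "digraph_on ?W ?G" using ok s Q(1) by (auto simp: digraph_on_def)
  have W: "?W = V \<union> Q" "finite ?W" using V Q(1) by auto
  have inW: "iso_type ?W ?G \<in> bounded n" using Q(3) nverts_iso_type[OF okW]
    by (simp add: bounded_def)
  have Vn: "card V \<le> n" using Q(3) card_mono[OF W(2), of V] by simp
  have "iso_type V E \<le> iso_type ?W ?G" using okW digraph_onD(2)[OF ok] EV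
    by (intro iso_type_mono) auto
  then have "f (iso_type V E) \<le> iso_type ?W ?G" using f_mono[OF _ inW] Z_fixed by metis
  then obtain V' E'
    where Y: "digraph_on V' E'" "V' \<subseteq> ?W" "E' \<subseteq> ?G" "f (iso_type V E) = iso_type V' E'"
    by (rule le_iso_typeE[OF _ okW])
  note E'V' = digraph_onD(3)[OF Y(1)] and E' = digraph_onD(4)[OF Y(1)]
  note cards = card_eqs[OF ok Y(1,4) Vn]
  \<comment> \<open>B is what survives of E, M what is lost, and Q' the set of pendants used instead.\<close>
  define B where "B = E' \<inter> E"
  define Q' where "Q' = {x \<in> Q. (s, x) \<in> E'}"
  define M where "M = E - E'"
  let ?q = "card Q'"
  have fin: "finite B" "finite Q'" "finite M" using E Q(1) by (auto simp: B_def Q'_def M_def)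
  have E_eq: "E = B \<union> M" "B \<inter> M = {}" by (auto simp: B_def M_def)
  have E'_eq: "E' = B \<union> {s} \<times> Q'" "B \<inter> {s} \<times> Q' = {}"
    using Y(3) EV Q(2) by (auto simp: B_def Q'_def)
  have "card E = card B + card M" unfolding E_eq(1) using fin E_eq(2)
    by (intro card_Un_disjoint) auto
  moreover have "card E' = card B + ?q"
    unfolding E'_eq(1) using fin E'_eq(2)
    by (subst card_Un_disjoint) (auto simp: card_cartesian_product)
  ultimately have cM: "card M = ?q" using cards by simp
  have qD: "?q \<le> card Q" using Q(1) by (intro card_mono) (auto simp: Q'_def)
  have dE: "outdeg E v = outdeg B v + outdeg M v" for v
    unfolding E_eq(1) using fin E_eq(2) by (intro outdeg_Un_disjoint) auto
  have dE': "outdeg E' v = outdeg B v + (if v = s then ?q else 0)" for v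
    unfolding E'_eq(1) using fin E'_eq(2)
    by (subst outdeg_Un_disjoint) (auto simp: outdeg_single_tail)
  have dM: "outdeg M v \<le> ?q" for v using outdeg_le_card[OF fin(3)] cM by metis
  have sums: "(\<Sum>v\<in>?W. min (outdeg E' v) t) = (\<Sum>v\<in>?W. min (outdeg E v) t)" for t
    using outdeg_sum_eq[OF ok Y(1,4) Vn] sum_outdeg_extend[OF W(2) Y(2) E'V']
      sum_outdeg_extend[OF W(2) _ EV] by simp
  \<comment> \<open>At s the cut-off hides any gain, and elsewhere the out-degree can only drop.\<close>
  have eq1: "min (outdeg E' v) ?d = min (outdeg E v) ?d" if "v \<in> ?W" for v
  proof (rule sum_mono_inv[OF sums _ that W(2)])
    show "min (outdeg E' w) ?d \<le> min (outdeg E w) ?d" for w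
      by (cases "w = s") (auto simp: dE dE')
  qed
  have low: "outdeg E' v = outdeg E v" if "v \<noteq> s" "outdeg E v \<le> ?d" "v \<in> ?W" for v
    using eq1[OF that(3)] that dE dE' by auto
  have noQ: "outdeg E v = 0" if "v \<notin> V" for v
  proof -
    have "E `` {v} = {}" using EV that by auto
    then show ?thesis by simp
  qed
  \<comment> \<open>The high out-degrees stay at or above this cut-off even after the loss of up to card
      Q edges.\<close>
  have eq2: "min (outdeg E s) (?d + card Q) = min (outdeg E' s) (?d + card Q)"
  proof (rule sum_mono_inv[OF sums[symmetric]])
    fix v assume v: "v \<in> ?W"
    consider "v = s" | "v \<noteq> s" "outdeg E v \<le> ?d" | "v \<noteq> s" "?d + 2 * card Q \<le> outdeg E v"
      using gap[of v] noQ[of v] by fastforce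
    then show "min (outdeg E v) (?d + card Q) \<le> min (outdeg E' v) (?d + card Q)"
    proof cases
      case 1
      then show ?thesis using eq1[of s] s by simp
    next
      case 2
      then show ?thesis using low v by simp
    next
      case 3
      then have "?d + 2 * card Q \<le> outdeg B v + ?q" using dE[of v] dM[of v] by simp
      then have "?d + card Q \<le> outdeg E' v" using dE'[of v] qD 3(1) by simp
      then show ?thesis by simp
    qed
  qed (use s W in auto)
  have "outdeg E' s \<le> ?d + card Q" using dE'[of s] dE[of s] qD by simp
  then have Ms: "outdeg M s = ?q" using eq2 dE[of s] dE'[of s] by simp
  define T where "T = M `` {s}"
  have "{s} \<times> T \<subseteq> M" by (auto simp: T_def)
  moreover have "card ({s} \<times> T) = card M" using Ms cM by (simp add: T_def card_cartesian_product)
  ultimately have M: "M = {s} \<times> T" using fin(3) by (metis card_subset_eq)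
  have T: "finite T" "card T = ?q" using Ms fin(3) by (auto simp: T_def intro: finite_Image)
  \<comment> \<open>In the image the new edges end in vertices without other edges. Counting the
      vertices that are not isolated forces the same for the lost edges.\<close>
  define F0 where "F0 = Field B \<union> {s}"
  have F0: "finite F0" "F0 \<subseteq> V" using finite_Field[OF fin(1)] EV s
    by (auto simp: F0_def B_def Field_def)
  have disj: "T \<inter> F0 = {}"
  proof (cases "?q = 0")
    case True
    then show ?thesis using T by simp
  next
    case False
    then have "T \<noteq> {}" "Q' \<noteq> {}" using T by auto
    then have FE: "Field E = F0 \<union> T" and FE': "Field E' = F0 \<union> Q'"
      unfolding E_eq(1) E'_eq(1) M F0_def by (auto simp: Field_def)
    have "F0 \<inter> Q' = {}" using F0(2) Q(2) by (auto simp: Q'_def)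
    then have "card (Field E') = card F0 + ?q"
      unfolding FE' using F0(1) fin(2) by (simp add: card_Un_disjoint)
    then have "card (F0 \<union> T) = card F0 + card T" using cards(3) FE T by simp
    then have "card (F0 \<inter> T) = 0" using card_Un_Int[OF F0(1) T(1)] by simp
    then show ?thesis using F0(1) by auto
  qed
  obtain h where h: "bij_betw h T Q'" using T fin(2) finite_same_card_bij by metis
  let ?g = "\<lambda>v. if v \<in> T then h v else v"
  have "iso_type V E = iso_type V' E'"
  proof (rule iso_type_eqI[OF ok Y(1) cards(1,2)[symmetric]])
    have "inj_on ?g (T \<union> F0)"
      using h disj F0(2) Q(2) 
      by (intro inj_on_disjoint_Un) (auto simp: bij_betw_def Q'_def)
    moreover have "Field E \<subseteq> T \<union> F0" unfolding E_eq(1) M F0_def by (auto simp: Field_def)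
    ultimately show "inj_on ?g (Field E)" by (rule inj_on_subset)
    show "map_prod ?g ?g ` E \<subseteq> E'"
    proof
      fix x assume "x \<in> map_prod ?g ?g ` E"
      then obtain a b where x: "x = (?g a, ?g b)" "(a, b) \<in> E" by auto
      then consider "(a, b) \<in> B" | "a = s" "b \<in> T" using E_eq(1) M by blast
      then show "x \<in> E'"
      proof cases
        case 1
        then have "a \<in> F0" "b \<in> F0" by (auto simp: F0_def Field_def)
        then have "a \<notin> T" "b \<notin> T" using disj by auto
        then show ?thesis using x 1 by (simp add: B_def)
      next
        case 2
        then have "s \<notin> T" using disj by (auto simp: F0_def)
        moreover have "h b \<in> Q'" using h 2 by (auto simp: bij_betw_def)
        ultimately show ?thesis using x 2 by (simp add: Q'_def)
      qed
    qed
  qed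
  with Y(4) show ?thesis by simp
qed

section \<open>Star forests\<close>

lemma sum_min_diff:
  fixes d :: "'a \<Rightarrow> nat"
  assumes "finite W"
  shows "(\<Sum>v\<in>W. min (d v) (Suc t)) = (\<Sum>v\<in>W. min (d v) t) + card {v\<in>W. t < d v}"
proof -
  have "(\<Sum>v\<in>W. min (d v) (Suc t)) = (\<Sum>v\<in>W. min (d v) t + (if t < d v then 1 else 0))"
    by (intro sum.cong) auto
  also have "\<dots> = (\<Sum>v\<in>W. min (d v) t) + card {v\<in>W. t < d v}"
    using assms by (simp add: sum.distrib flip: sum.inter_filter)
  finally show ?thesis .
qed

text \<open>
  The numbers of vertices of out-degree greater than \<open>t\<close> are the increments of the sums.
\<close>

lemma card_degree_eq:
  fixes d :: "'a \<Rightarrow> nat" and d' :: "'b \<Rightarrow> nat"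
  assumes "finite W" "finite W'"
    and eq: "\<And>t. (\<Sum>v\<in>W'. min (d' v) t) = (\<Sum>v\<in>W. min (d v) t)" and "0 < k"
  shows "card {v\<in>W'. d' v = k} = card {v\<in>W. d v = k}"
proof -
  have gt: "card {v\<in>W'. t < d' v} = card {v\<in>W. t < d v}" for t
    using sum_min_diff[OF assms(1), of d t] sum_min_diff[OF assms(2), of d' t] eq[of t] eq[of "Suc t"]
    by simp
  have diff: "card {v\<in>A. e v = k} = card {v\<in>A. k - 1 < e v} - card {v\<in>A. k < e v}"
    if "finite A" for A :: "'c set" and e :: "'c \<Rightarrow> nat"
  proof -
    have "{v\<in>A. e v = k} = {v\<in>A. k - 1 < e v} - {v\<in>A. k < e v}" using \<open>0 < k\<close> by auto
    also have "card \<dots> = card {v\<in>A. k - 1 < e v} - card {v\<in>A. k < e v}"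
      using that by (intro card_Diff_subset) auto
    finally show ?thesis .
  qed
  show ?thesis unfolding diff[OF assms(1)] diff[OF assms(2)] gt ..
qed

lemma sum_min_1:
  assumes "finite V" "E \<subseteq> V \<times> V"
  shows "(\<Sum>v\<in>V. min (outdeg E v) 1) = card (Domain E)"
proof -
  have fin: "finite E" using assms by (auto intro: finite_subset)
  have "min (outdeg E v) 1 = (if v \<in> Domain E then 1 else 0)" for v
  proof (cases "v \<in> Domain E")
    case True
    then have "E `` {v} \<noteq> {}" by auto
    then have "outdeg E v > 0" using fin by (simp add: card_gt_0_iff finite_Image)
    with True show ?thesis by simp
  next
    case False
    then have "E `` {v} = {}" by auto
    with False show ?thesis by simp
  qed
  then have "(\<Sum>v\<in>V. min (outdeg E v) 1) = card {v\<in>V. v \<in> Domain E}"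
    using assms(1) by (simp flip: sum.inter_filter)
  also have "{v\<in>V. v \<in> Domain E} = Domain E" using assms(2) by auto
  finally show ?thesis .
qed

lemma (in oriented_embedding) card_Domain_eq:
  assumes "digraph_on V E" "digraph_on V' E'" "f (iso_type V E) = iso_type V' E'" "card V \<le> n"
  shows "card (Domain E') = card (Domain E)"
  using outdeg_sum_eq[OF assms, of 1] sum_min_1[OF digraph_onD(1,3)[OF assms(1)]]
    sum_min_1[OF digraph_onD(1,3)[OF assms(2)]]
  by simp

lemma (in oriented_embedding) card_Range_eq:
  assumes "digraph_on V E" "digraph_on V' E'" "f (iso_type V E) = iso_type V' E'" "card V \<le> n"
  shows "card (Range E') = card (Range E)"
  using indeg_sum_eq[OF assms, of 1]
    sum_min_1[OF digraph_onD(1,3)[OF digraph_on_converse[OF assms(1)]]]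
      sum_min_1[OF digraph_onD(1,3)[OF digraph_on_converse[OF assms(2)]]]
  by simp

text \<open>
  A digraph with the same number of vertices as one below it can be drawn on the same vertex set.
\<close>

lemma le_spanningE:
  assumes "iso_type V E \<le> X" "digraph_on V E" "nverts X = card V"
  obtains G where "digraph_on V G" "E \<subseteq> G" "X = iso_type V G"
proof -
  obtain V' :: "nat set" and E' where X: "digraph_on V' E'" "X = iso_type V' E'"
    by (rule ex_iso_type)
  obtain g where g: "inj_on g V" "g ` V \<subseteq> V'" "map_prod g g ` E \<subseteq> E'"
    using assms(1) unfolding X(2) iso_type_le_iff[OF assms(2) X(1)] by blast
  have V': "g ` V = V'"
    using g assms(3) X digraph_onD(1)[OF X(1)] by (intro card_subset_eq) (auto simp: card_image)
  let ?G = "{(a, b) \<in> V \<times> V. (g a, g b) \<in> E'}"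
  have ok: "digraph_on V ?G" using assms(2) by (auto simp: digraph_on_def)
  have inj: "inj_on (map_prod g g) ?G" using g(1) by (rule inj_map_prod) auto
  have im: "map_prod g g ` ?G = E'"
  proof
    show "E' \<subseteq> map_prod g g ` ?G"
    proof
      fix x assume x: "x \<in> E'"
      then obtain a b where "a \<in> V" "b \<in> V" "x = (g a, g b)"
        using digraph_onD(3)[OF X(1)] unfolding V'[symmetric] by auto
      then show "x \<in> map_prod g g ` ?G" using x by (intro image_eqI[of _ _ "(a, b)"]) auto
    qed
  qed auto
  have "iso_type V ?G \<le> X"
    unfolding X(2) iso_type_le_iff[OF ok X(1)] using g im by (intro exI[of _ g]) simp
  moreover have "nedges (iso_type V ?G) = nedges X"
    using im card_image[OF inj] nedges_iso_type[OF ok] nedges_iso_type[OF X(1)] X(2) by simp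
  ultimately have "iso_type V ?G = X" using assms(3) nverts_iso_type[OF ok]
    by (intro iso_type_eqI_card) simp_all
  moreover have "E \<subseteq> ?G" using digraph_onD(3)[OF assms(2)] g(3) by auto
  ultimately show thesis using ok that by blast
qed

lemma card_Field_split:
  assumes "finite E"
  shows "card (Field E) + card (Domain E \<inter> Range E) = card (Domain E) + card (Range E)"
  unfolding Field_def using assms card_Un_Int[of "Domain E" "Range E"]
  by (simp add: finite_Domain finite_Range)

lemma outdeg_insert:
  assumes "(u, v) \<notin> E" "finite E"
  shows "outdeg (insert (u, v) E) w = outdeg E w + (if w = u then 1 else 0)"
proof -
  have "insert (u, v) E `` {w} = (if w = u then insert v (E `` {w}) else E `` {w})" by auto
  moreover have "w = u \<Longrightarrow> v \<notin> E `` {w}" using assms(1) by auto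
  ultimately show ?thesis using assms(2) by (simp add: finite_Image)
qed

text \<open>
  An edge added at a vertex of out-degree \<open>d\<close> raises the sum exactly for the cut-offs above \<open>d\<close>.
\<close>

lemma degree_of_extra_edge:
  assumes fin: "finite W" "finite E"
    and uv: "u \<in> W" "(u, v) \<notin> E" and xy: "x \<in> W" "(x, y) \<notin> E"
    and eq: "\<And>t. (\<Sum>w\<in>W. min (outdeg (insert (x, y) E) w) t) = (\<Sum>w\<in>W. min (outdeg (insert (u, v) E) w) t)"
  shows "outdeg E x = outdeg E u"
proof -
  have step: "(\<Sum>w\<in>W. min (outdeg (insert (a, b) E) w) t) =
      (\<Sum>w\<in>W. min (outdeg E w) t) + (if outdeg E a < t then 1 else 0)"
    if "a \<in> W" "(a, b) \<notin> E" for a b t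
  proof -
    have "(\<Sum>w\<in>W. min (outdeg (insert (a, b) E) w) t) =
      (\<Sum>w\<in>W. min (outdeg E w) t + (if w = a then (if outdeg E a < t then 1 else 0) else 0))"
      unfolding outdeg_insert[OF that(2) fin(2)] by (intro sum.cong) auto
    also have "\<dots> = (\<Sum>w\<in>W. min (outdeg E w) t) + (if outdeg E a < t then 1 else 0)"
      using fin(1) that(1) by (simp add: sum.distrib)
    finally show ?thesis .
  qed
  have "outdeg E x < t \<longleftrightarrow> outdeg E u < t" for t
    using eq[of t] unfolding step[OF xy] step[OF uv] by (auto split: if_splits)
  from this[of "outdeg E x"] this[of "outdeg E u"] show ?thesis by simp
qed

text \<open>
  If all in-degrees are at most one, these conditions say that two vertices have positive
  out-degree and that exactly one of them is the head of an edge. In a star forest with an extra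
  edge between two different centres this happens only for subgraphs of the component that
  contains the extra edge.
\<close>

definition two_tailed_tree :: "digraph_type \<Rightarrow> bool" where
  "two_tailed_tree H \<longleftrightarrow> outdeg_sum 1 H = 2 \<and> nsupport H = nedges H + 1"

lemma two_tailed_tree_iff:
  assumes "digraph_on V E"
  shows "two_tailed_tree (iso_type V E) \<longleftrightarrow> card (Domain E) = 2 \<and> card (Field E) = card E + 1"
  unfolding two_tailed_tree_def outdeg_sum_iso_type[OF assms] nsupport_iso_type[OF assms]
    nedges_iso_type[OF assms]
    sum_min_1[OF digraph_onD(1,3)[OF assms]] ..

lemma (in oriented_embedding) two_tailed_tree_f: "X \<in> bounded n \<Longrightarrow> two_tailed_tree (f X) \<longleftrightarrow> two_tailed_tree X"
  by (simp add: two_tailed_tree_def outdeg_sum_f nsupport_f nedges_f)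

text \<open>
  The vertices in \<open>Q\<close> are the leaves. The sizes of the stars exceed \<open>k\<close> and differ by more than
  \<open>k\<close>, so that the stars are still recognised by their out-degrees when up to \<open>k\<close> edges are added.
\<close>

locale star_forest = oriented_embedding n f
  for n :: nat and f +
  fixes C Q :: "'a set" and centre :: "'a \<Rightarrow> 'a" and k :: nat
  assumes finC: "finite C" and C0: "C \<noteq> {}" and finQ: "finite Q" and CQ: "C \<inter> Q = {}"
    and centre: "\<And>q. q \<in> Q \<Longrightarrow> centre q \<in> C"
    and size: "card (C \<union> Q) \<le> n"
    and big: "\<And>c. c \<in> C \<Longrightarrow> k < card {q \<in> Q. centre q = c}"
    and spread: "\<And>c c'. c \<in> C \<Longrightarrow> c' \<in> C \<Longrightarrow> c \<noteq> c' \<Longrightarrow>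
      card {q \<in> Q. centre q = c} + k < card {q \<in> Q. centre q = c'} \<or>
      card {q \<in> Q. centre q = c'} + k < card {q \<in> Q. centre q = c}"
begin

definition "leaves c = {q \<in> Q. centre q = c}"
definition "W = C \<union> Q"
definition "F = (\<lambda>q. (centre q, q)) ` Q"

lemma W: "finite W" "W \<noteq> {}" "card W \<le> n" "card W = card C + card Q"
  using finC finQ C0 size CQ by (auto simp: W_def card_Un_disjoint)

lemma digraph_on_forest: "digraph_on W F"
  using W centre by (auto simp: digraph_on_def W_def F_def)

lemma leaves: "finite (leaves c)" "c \<in> C \<Longrightarrow> k < card (leaves c)"
  using finQ big by (auto simp: leaves_def)

lemma leaves_ne: "c \<in> C \<Longrightarrow> leaves c \<noteq> {}"
  using leaves(2)[of c] by auto

lemma leaves_spread: "c \<in> C \<Longrightarrow> c' \<in> C \<Longrightarrow> card (leaves c) \<le> card (leaves c') + k \<Longrightarrow>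
    c = c' \<or> card (leaves c) < card (leaves c')"
  using spread[of c c'] unfolding leaves_def by linarith

lemma inj_leaves: "c \<in> C \<Longrightarrow> c' \<in> C \<Longrightarrow> card (leaves c) = card (leaves c') \<Longrightarrow> c = c'"
  using spread[of c c'] unfolding leaves_def by fastforce

lemma F_Image: "F `` {v} = (if v \<in> C then leaves v else {})"
  using centre by (auto simp: F_def leaves_def)

lemma outdeg_F: "outdeg F v = (if v \<in> C then card (leaves v) else 0)"
  by (simp add: F_Image)

lemma indeg_F: "outdeg (F\<inverse>) v = (if v \<in> Q then 1 else 0)"
proof -
  have "(F\<inverse>) `` {v} = (if v \<in> Q then {centre v} else {})" by (auto simp: F_def)
  then show ?thesis by simp
qed

lemma card_F: "card F = card Q"
  unfolding F_def by (rule card_image) (auto simp: inj_on_def)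

lemma Domain_F: "Domain F = C"
  using leaves_ne centre by (force simp: F_def leaves_def)

lemma Range_F: "Range F = Q"
  by (force simp: F_def)

lemma Field_F: "Field F = W"
  by (simp add: Field_def Domain_F Range_F W_def)

text \<open>
  There are no isolated vertices, and the numbers of tails and heads add up to the number of
  vertices. So in the image no tail is a head. As there are as many heads as edges, all in-degrees
  are at most one. Hence the image is again a star forest, and the out-degree sequence gives the
  sizes of its stars.
\<close>

lemma f_forest: "f (iso_type W F) = iso_type W F"
proof -
  obtain W' :: "nat set" and F' where X: "digraph_on W' F'" "f (iso_type W F) = iso_type W' F'"
    by (rule ex_iso_type)
  note F' = digraph_onD(4)[OF X(1)]
  note cards = card_eqs[OF digraph_on_forest X W(3)]
  have Dom: "card (Domain F') = card C" using card_Domain_eq[OF digraph_on_forest X W(3)] Domain_F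
    by simp
  have Ran: "card (Range F') = card Q" using card_Range_eq[OF digraph_on_forest X W(3)] Range_F
    by simp
  have "card (Domain F' \<inter> Range F') = 0"
    using card_Field_split[OF F'] cards(3) W(4) unfolding Field_F Dom Ran by simp
  then have disj: "Domain F' \<inter> Range F' = {}" using F' by (simp add: finite_Domain)
  have "card (snd ` F') = card F'" using Ran cards(2) card_F by (simp add: Range_snd)
  then have inj: "inj_on snd F'" using F' by (rule eq_card_imp_inj_on[rotated])
  have one: "\<exists>!v. v \<in> W' \<and> outdeg F' v = card (leaves c)" if c: "c \<in> C" for c
  proof -
    have "card {v\<in>W'. outdeg F' v = card (leaves c)} = card {v\<in>W. outdeg F v = card (leaves c)}"
      using leaves(2)[OF c] outdeg_sum_eq[OF digraph_on_forest X W(3)] W(1) digraph_onD(1)[OF X(1)]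
      by (intro card_degree_eq) auto
    also have "{v\<in>W. outdeg F v = card (leaves c)} = {c}"
      using c inj_leaves leaves(2)[OF c] by (auto simp: outdeg_F W_def)
    finally have "is_singleton {v\<in>W'. outdeg F' v = card (leaves c)}"
      by (simp add: is_singleton_altdef)
    then obtain x where "{v\<in>W'. outdeg F' v = card (leaves c)} = {x}"
      by (auto simp: is_singleton_def)
    then show ?thesis by (intro ex1I[of _ x]) blast+
  qed
  \<comment> \<open>The centre of the star in the image that has as many leaves as the star at c.\<close>
  define b where "b c = (THE v. v \<in> W' \<and> outdeg F' v = card (leaves c))" for c
  have b: "b c \<in> W'" "outdeg F' (b c) = card (leaves c)" if "c \<in> C" for c
    using theI'[OF one[OF that]] by (simp_all add: b_def)
  have b_inj: "inj_on b C"
    by (rule inj_onI) (metis b(2) inj_leaves)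
  have "\<exists>h. bij_betw h (leaves c) (F' `` {b c})" if "c \<in> C" for c
    using b(2)[OF that] leaves(1) F' by (intro finite_same_card_bij) (auto intro: finite_Image)
  then obtain e where e: "\<And>c. c \<in> C \<Longrightarrow> bij_betw (e c) (leaves c) (F' `` {b c})" by metis
  define g where "g x = (if x \<in> C then b x else e (centre x) x)" for x
  have gQ: "(b (centre q), g q) \<in> F'" if "q \<in> Q" for q
  proof -
    have "q \<in> leaves (centre q)" "q \<notin> C" using that CQ by (auto simp: leaves_def)
    then show ?thesis using e[OF centre[OF that]] by (auto simp: g_def bij_betw_def)
  qed
  have gF: "map_prod g g ` F \<subseteq> F'"
    using gQ centre by (auto simp: F_def g_def)
  have gC: "g c \<in> Domain F'" if "c \<in> C" for c
  proof -
    from leaves_ne[OF that] obtain q where "q \<in> leaves c" by blast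
    then show ?thesis using gQ[of q] that by (auto simp: leaves_def g_def)
  qed
  have "inj_on g (C \<union> Q)"
  proof (subst inj_on_Un, intro conjI)
    show "inj_on g C" using b_inj by (auto simp: g_def inj_on_def)
    show "inj_on g Q"
    proof (rule inj_onI)
      fix q q' assume q: "q \<in> Q" "q' \<in> Q" "g q = g q'"
      have "(b (centre q), g q') \<in> F'" using gQ[OF q(1)] q(3) by simp
      from inj_onD[OF inj _ this gQ[OF q(2)]] have "b (centre q) = b (centre q')" by simp
      then have c: "centre q = centre q'" using inj_onD[OF b_inj] centre q by simp
      have "q \<notin> C" "q' \<notin> C" using q CQ by auto
      then have "e (centre q) q = e (centre q) q'" using q(3) c by (simp add: g_def)
      moreover have "q \<in> leaves (centre q)" "q' \<in> leaves (centre q)"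
        using q c by (auto simp: leaves_def)
      ultimately show "q = q'"
        using e[OF centre[OF q(1)]] by (auto simp: bij_betw_def dest: inj_onD)
    qed
    have "g ` Q \<subseteq> Range F'" using gQ by blast
    moreover have "g ` C \<subseteq> Domain F'" using gC by blast
    ultimately show "g ` (C - Q) \<inter> g ` (Q - C) = {}" using disj by blast
  qed
  moreover have "g ` W \<subseteq> W'"
    using gQ gC digraph_onD(3)[OF X(1)] by (fastforce simp: W_def)
  ultimately have "iso_type W F \<le> iso_type W' F'"
    unfolding iso_type_le_iff[OF digraph_on_forest X(1)] using gF by (auto simp: W_def)
  then have "iso_type W F = iso_type W' F'"
    using cards nverts_iso_type[OF digraph_on_forest] nverts_iso_type[OF X(1)]
      nedges_iso_type[OF digraph_on_forest] nedges_iso_type[OF X(1)]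
    by (intro iso_type_eqI_card) simp_all
  with X(2) show ?thesis by simp
qed

abbreviation "add_edge u v \<equiv> insert (u, v) F"

lemma digraph_on_forest_Un: "E \<subseteq> C \<times> C \<Longrightarrow> digraph_on W (F \<union> E)"
  using digraph_on_forest by (auto simp: digraph_on_def W_def)

lemma F_core: "(u, v) \<in> F \<Longrightarrow> v \<notin> C"
  using CQ by (auto simp: F_def)

lemma two_tailed_tree_le:
  assumes "u \<in> C" "v \<in> C" "u \<noteq> v" "H \<le> iso_type W (add_edge u v)" "two_tailed_tree H"
  shows "nedges H \<le> card (leaves u) + card (leaves v) + 1"
proof -
  have ok: "digraph_on W (add_edge u v)" using digraph_on_forest_Un[of "{(u, v)}"] assms by simp
  obtain W' H' where H: "digraph_on W' H'" "H' \<subseteq> add_edge u v" "H = iso_type W' H'"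
    by (rule le_iso_typeE[OF assms(4) ok])
  have tt: "card (Domain H') = 2" "card (Field H') = card H' + 1"
    using assms(5) unfolding H(3) two_tailed_tree_iff[OF H(1)] by auto
  note finH = digraph_onD(4)[OF H(1)]
  have "inj_on snd (add_edge u v)" using assms(2) CQ by (auto simp: inj_on_def F_def)
  then have "inj_on snd H'" using H(2) by (rule inj_on_subset)
  then have "card (Range H') = card H'" unfolding Range_snd by (rule card_image)
  then have "card (Domain H' \<inter> Range H') = 1" using card_Field_split[OF finH] tt by simp
  then have "Domain H' \<inter> Range H' \<noteq> {}" by auto
  then obtain x y z where xyz: "(x, y) \<in> H'" "(z, x) \<in> H'" by auto
  have "x \<in> C" using xyz(1) H(2) assms(1) centre by (auto simp: F_def)
  then have "(z, x) = (u, v)" using xyz(2) H(2) F_core by auto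
  then have "{u, v} \<subseteq> Domain H'" using xyz by auto
  then have D: "Domain H' = {u, v}"
    using tt(1) assms(3) finH by (metis card_2_iff card_subset_eq finite_Domain)
  have "H' \<subseteq> insert (u, v) ((\<lambda>q. (centre q, q)) ` (leaves u \<union> leaves v))"
  proof
    fix e assume e: "e \<in> H'"
    then have "fst e = u \<or> fst e = v" using D by (metis Domain_fst image_eqI insertE singletonD)
    moreover have "e \<in> add_edge u v" using e H(2) by blast
    ultimately show "e \<in> insert (u, v) ((\<lambda>q. (centre q, q)) ` (leaves u \<union> leaves v))"
      by (auto simp: F_def leaves_def)
  qed
  then have "card H' \<le> card (insert (u, v) ((\<lambda>q. (centre q, q)) ` (leaves u \<union> leaves v)))"
    using leaves(1) by (intro card_mono) auto
  also have "\<dots> \<le> Suc (card ((\<lambda>q. (centre q, q)) ` (leaves u \<union> leaves v)))"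
    by (rule card_insert_le_m1) simp_all
  also have "card ((\<lambda>q. (centre q, q)) ` (leaves u \<union> leaves v)) \<le> card (leaves u \<union> leaves v)"
    using leaves(1) by (intro card_image_le) auto
  also have "card (leaves u \<union> leaves v) \<le> card (leaves u) + card (leaves v)" by (rule card_Un_le)
  finally show ?thesis using H by simp
qed

lemma ex_two_tailed_tree:
  assumes "u \<in> C" "v \<in> C" "u \<noteq> v"
  obtains H where "H \<le> iso_type W (add_edge u v)" "two_tailed_tree H"
    "nedges H = card (leaves u) + card (leaves v) + 1"
proof -
  let ?L = "leaves u \<union> leaves v"
  let ?H = "insert (u, v) ((\<lambda>q. (centre q, q)) ` ?L)"
  have ok: "digraph_on W (add_edge u v)" using digraph_on_forest_Un[of "{(u, v)}"] assms by simp
  have sub: "?H \<subseteq> add_edge u v" by (auto simp: F_def leaves_def)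
  then have okH: "digraph_on W ?H" using ok by (auto simp: digraph_on_def)
  have L: "finite ?L" "?L \<inter> C = {}" using leaves(1) CQ by (auto simp: leaves_def)
  have "leaves u \<inter> leaves v = {}" using assms(3) by (auto simp: leaves_def)
  then have cL: "card ?L = card (leaves u) + card (leaves v)"
    using leaves(1) by (simp add: card_Un_disjoint)
  have inj: "inj_on (\<lambda>q. (centre q, q)) ?L" by (auto simp: inj_on_def)
  have "(u, v) \<notin> (\<lambda>q. (centre q, q)) ` ?L" using L(2) assms(2) by auto
  then have card: "card ?H = card ?L + 1" using L(1) card_image[OF inj] by simp
  have D: "Domain ?H = {u, v}"
    using leaves_ne[OF assms(2)] by (auto simp: leaves_def)
  have "Field ?H = {u, v} \<union> ?L" unfolding Field_def D by auto
  moreover have "{u, v} \<inter> ?L = {}" using L(2) assms by auto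
  ultimately have F: "card (Field ?H) = 2 + card ?L"
    using L(1) assms(3) by (simp only: card_Un_disjoint finite.intros) simp
  show thesis
  proof (rule that[of "iso_type W ?H"])
    show "iso_type W ?H \<le> iso_type W (add_edge u v)"
      using ok digraph_onD(2,3)[OF okH] sub by (intro iso_type_mono) auto
    show "two_tailed_tree (iso_type W ?H)"
      unfolding two_tailed_tree_iff[OF okH] D F card using assms(3) by simp
    show "nedges (iso_type W ?H) = card (leaves u) + card (leaves v) + 1"
      unfolding nedges_iso_type[OF okH] card cL ..
  qed
qed

text \<open>
  The image is the forest with one extra edge \<open>(x, y)\<close>, since the forest is fixed. The out-degree
  sequence gives \<open>x = u\<close>, as stars of different centres have different sizes. The in-degree
  sequence only tells that \<open>y\<close> is a centre. Whether \<open>y = u\<close> is decided by the presence of a loop;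
  otherwise the size of the component of the extra edge determines the size of the star at \<open>y\<close>.
\<close>

lemma f_forest_edge:
  assumes u: "u \<in> C" and v: "v \<in> C"
  shows "f (iso_type W (add_edge u v)) = iso_type W (add_edge u v)"
proof -
  let ?X = "iso_type W (add_edge u v)"
  have ok: "digraph_on W (add_edge u v)" using digraph_on_forest_Un[of "{(u, v)}"] u v by simp
  have X: "?X \<in> bounded n" using nverts_iso_type[OF ok] W(3) by (simp add: bounded_def)
  have "iso_type W F \<le> ?X" using ok W(2) digraph_onD(3)[OF digraph_on_forest]
    by (intro iso_type_mono) auto
  then have le: "iso_type W F \<le> f ?X" using f_mono[OF _ X] f_forest by metis
  have "nverts (f ?X) = card W" using nverts_f[OF X] nverts_iso_type[OF ok] by simp
  then obtain G where G: "digraph_on W G" "F \<subseteq> G" "f ?X = iso_type W G"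
    by (rule le_spanningE[OF le digraph_on_forest])
  have uvF: "(u, v) \<notin> F" using F_core v by blast
  note finF = digraph_onD(4)[OF digraph_on_forest]
  have "card G = card F + 1"
    using card_eqs(2)[OF ok G(1,3) W(3)] uvF finF by simp
  then have "card (G - F) = 1" using card_Diff_subset[OF finF G(2)] by simp
  then obtain x y where "G - F = {(x, y)}" by (auto simp: card_1_singleton_iff)
  then have xy: "(x, y) \<notin> F" "G = add_edge x y" using G(2) by auto
  have xyW: "x \<in> W" "y \<in> W" using digraph_onD(3)[OF G(1)] xy(2) by auto
  have uvW: "u \<in> W" "v \<in> W" using u v by (auto simp: W_def)
  have "outdeg F x = outdeg F u"
    using outdeg_sum_eq[OF ok G(1,3) W(3)] unfolding xy(2)
    by (intro degree_of_extra_edge[OF W(1) finF uvW(1) uvF xyW(1) xy(1)]) auto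
  then have x: "x = u" using u leaves(2)[of u] inj_leaves by (auto simp: outdeg_F split: if_splits)
  have conv: "(insert (a, b) F)\<inverse> = insert (b, a) (F\<inverse>)" for a b by auto
  have "outdeg (F\<inverse>) y = outdeg (F\<inverse>) v"
    using indeg_sum_eq[OF ok G(1,3) W(3)] uvF xy(1) finF unfolding xy(2) conv
    by (intro degree_of_extra_edge[OF W(1) _ uvW(2) _ xyW(2), where v = u and y = x]) auto
  then have y: "y \<in> C" using v CQ xyW(2) by (auto simp: indeg_F W_def split: if_splits)
  have noloop: "(w, w) \<notin> F" for w using F_core[of w w] Domain_F by blast
  have "u = v \<longleftrightarrow> loop_type \<le> ?X" unfolding loop_le_iff[OF ok] using noloop by auto
  also have "\<dots> \<longleftrightarrow> loop_type \<le> f ?X" using loop_le_f[OF X] by simp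
  also have "\<dots> \<longleftrightarrow> u = y"
    unfolding G(3) loop_le_iff[OF G(1)] unfolding xy(2) x using noloop by auto
  finally have uv_iff: "u = v \<longleftrightarrow> u = y" .
  have "y = v"
  proof (cases "u = v")
    case True
    then show ?thesis using uv_iff by simp
  next
    case False
    then have uy: "u \<noteq> y" using uv_iff by simp
    have fX: "f ?X = iso_type W (add_edge u y)" using G(3) xy(2) x by simp
    obtain H
      where H: "H \<le> ?X" "two_tailed_tree H" "nedges H = card (leaves u) + card (leaves v) + 1"
      by (rule ex_two_tailed_tree[OF u v False])
    have HP: "H \<in> bounded n" using H(1) X bounded_downset by blast
    have "f H \<le> iso_type W (add_edge u y)" using f_mono[OF H(1) X] fX by simp
    moreover have "two_tailed_tree (f H)" using two_tailed_tree_f[OF HP] H(2) by simp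
    ultimately have "nedges (f H) \<le> card (leaves u) + card (leaves y) + 1"
      by (rule two_tailed_tree_le[OF u y uy])
    then have 1: "card (leaves v) \<le> card (leaves y)" using nedges_f[OF HP] H(3) by simp
    obtain K where K: "K \<le> iso_type W (add_edge u y)" "two_tailed_tree K"
      "nedges K = card (leaves u) + card (leaves y) + 1"
      by (rule ex_two_tailed_tree[OF u y uy])
    obtain H' where H': "H' \<le> ?X" "K = f H'" by (rule le_fE[OF K(1)[folded fX] X])
    have HP': "H' \<in> bounded n" using H'(1) X bounded_downset by blast
    have "two_tailed_tree H'" using two_tailed_tree_f[OF HP'] K(2) H'(2) by simp
    with H'(1) have "nedges H' \<le> card (leaves u) + card (leaves v) + 1"
      by (rule two_tailed_tree_le[OF u v False])
    then have "card (leaves y) \<le> card (leaves v)" using nedges_f[OF HP'] K(3) H'(2) by simp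
    with 1 show ?thesis using inj_leaves[OF y v] by simp
  qed
  then show ?thesis using G(3) xy(2) x by simp
qed

text \<open>
  For each edge \<open>(u, v)\<close> the image lies above the forest with the extra edge \<open>(u, v)\<close>. An
  embedding of the latter maps every centre to itself, because the out-degree in the image exceeds
  that in the forest by at most \<open>k\<close>. So the image contains all the edges, and it has no room for
  others.
\<close>

lemma f_forest_edges:
  assumes E: "E \<subseteq> C \<times> C" "card E \<le> k"
  shows "f (iso_type W (F \<union> E)) = iso_type W (F \<union> E)"
proof -
  let ?X = "iso_type W (F \<union> E)"
  have ok: "digraph_on W (F \<union> E)" using digraph_on_forest_Un[OF E(1)] .
  have X: "?X \<in> bounded n" using nverts_iso_type[OF ok] W(3) by (simp add: bounded_def)
  have "iso_type W F \<le> ?X" using ok W(2) digraph_onD(3)[OF digraph_on_forest]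
    by (intro iso_type_mono) auto
  then have le: "iso_type W F \<le> f ?X" using f_mono[OF _ X] f_forest by metis
  have "nverts (f ?X) = card W" using nverts_f[OF X] nverts_iso_type[OF ok] by simp
  then obtain G where G: "digraph_on W G" "F \<subseteq> G" "f ?X = iso_type W G"
    by (rule le_spanningE[OF le digraph_on_forest])
  note finF = digraph_onD(4)[OF digraph_on_forest] and finG = digraph_onD(4)[OF G(1)]
  have finE: "finite E" using E(1) finC by (auto intro: finite_subset)
  have FE: "F \<inter> E = {}" using F_core E(1) by auto
  have cG: "card G = card F + card E"
    using card_eqs(2)[OF ok G(1,3) W(3)] card_Un_disjoint[OF finF finE FE] by simp
  have dG: "outdeg G w \<le> outdeg F w + k" for w
  proof -
    have "outdeg G w = outdeg (F \<union> (G - F)) w" using G(2) by (simp add: Un_absorb1)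
    also have "\<dots> = outdeg F w + outdeg (G - F) w"
      using finF finG by (intro outdeg_Un_disjoint) auto
    also have "outdeg (G - F) w \<le> card (G - F)" using finG by (intro outdeg_le_card) simp
    also have "card (G - F) = card E" using cG card_Diff_subset[OF finF G(2)] by simp
    finally show ?thesis using E(2) by simp
  qed
  have "(u, v) \<in> G" if uv: "(u, v) \<in> E" for u v
  proof -
    have uC: "u \<in> C" "v \<in> C" using uv E(1) by auto
    have ok1: "digraph_on W (add_edge u v)" using digraph_on_forest_Un[of "{(u, v)}"] uC by simp
    have "iso_type W (add_edge u v) \<le> ?X"
      using ok W(2) digraph_onD(3)[OF ok1] uv by (intro iso_type_mono) auto
    then have "iso_type W (add_edge u v) \<le> iso_type W G"
      using f_mono[OF _ X] f_forest_edge[OF uC] G(3) by metis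
    then obtain g where g: "inj_on g W" "g ` W \<subseteq> W" "map_prod g g ` add_edge u v \<subseteq> G"
      unfolding iso_type_le_iff[OF ok1 G(1)] by blast
    have gd: "card (leaves c) \<le> outdeg G (g c)" if c: "c \<in> C" for c
    proof -
      have "g ` (leaves c) \<subseteq> G `` {g c}"
        using g(3) c by (fastforce simp: leaves_def F_def)
      moreover have "inj_on g (leaves c)"
        using g(1) by (rule inj_on_subset) (auto simp: leaves_def W_def)
      ultimately show ?thesis
        using finG by (metis card_image card_mono finite_Image)
    qed
    \<comment> \<open>By induction from the largest star downwards: c can only move to a larger star,
        whose centre is already taken.\<close>
    have fixed: "g c = c" if "c \<in> C" for c
      using that
    proof (induction "card Q - card (leaves c)" arbitrary: c rule: less_induct)
      case less
      have le: "card (leaves c) \<le> outdeg F (g c) + k"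
        using gd[OF less.prems] dG[of "g c"] by simp
      with leaves(2)[OF less.prems] have gC: "g c \<in> C"
        by (simp add: outdeg_F split: if_splits)
      then have "c = g c \<or> card (leaves c) < card (leaves (g c))"
        using le leaves_spread[OF less.prems gC] by (simp add: outdeg_F)
      then show ?case
      proof
        assume lt: "card (leaves c) < card (leaves (g c))"
        have "card (leaves (g c)) \<le> card Q" using finQ by (intro card_mono) (auto simp: leaves_def)
        then have "g (g c) = g c" using lt gC by (intro less.hyps) auto
        then have "g c = c" using inj_onD[OF g(1)] gC less.prems by (simp add: W_def)
        then show ?thesis .
      qed simp
    qed
    have "(g u, g v) \<in> G" using g(3) by auto
    then show ?thesis using fixed uC by simp
  qed
  then have "F \<union> E \<subseteq> G" using G(2) by auto
  then have "F \<union> E = G"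
    using finG cG card_Un_disjoint[OF finF finE FE] by (intro card_subset_eq) auto
  with G(3) show ?thesis by simp
qed

end

section \<open>Marking the vertices of a digraph by pendants\<close>

text \<open>
  The ordering by out-degree is what allows \<open>strip_pendants\<close> to be applied to the vertices one by
  one.
\<close>

lemma ex_sorted_iso_type:
  obtains E :: "(nat \<times> nat) set" where "digraph_on {..<nverts X} E" "X = iso_type {..<nverts X} E"
    "\<forall>i j. i \<le> j \<longrightarrow> j < nverts X \<longrightarrow> outdeg E j \<le> outdeg E i"
proof -
  obtain V :: "nat set" and E where X: "digraph_on V E" "X = iso_type V E" by (rule ex_iso_type)
  note V = digraph_onD(1)[OF X(1)]
  define xs where "xs = rev (sort_key (outdeg E) (sorted_list_of_set V))"
  have xs: "distinct xs" "set xs = V" "length xs = nverts X"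
    using V X by (simp_all add: xs_def)
  have decr: "outdeg E (xs ! j) \<le> outdeg E (xs ! i)" if "i \<le> j" "j < length xs" for i j
  proof -
    have "sorted (map (outdeg E) (sort_key (outdeg E) (sorted_list_of_set V)))" by simp
    then have "sorted_wrt (\<lambda>x y. outdeg E y \<le> outdeg E x) xs"
      unfolding xs_def sorted_wrt_rev sorted_map by simp
    with that show ?thesis by (cases "i = j") (auto simp: sorted_wrt_iff_nth_less)
  qed
  let ?I = "{..<nverts X}" and ?b = "\<lambda>i. xs ! i"
  have b: "bij_betw ?b ?I V" using bij_betw_nth[OF xs(1)] xs by auto
  have inj: "inj_on ?b ?I" using b by (simp add: bij_betw_def)
  define E' where "E' = {(i, j) \<in> ?I \<times> ?I. (xs ! i, xs ! j) \<in> E}"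
  have ok: "digraph_on ?I E'" using nverts_pos[of X] by (auto simp: digraph_on_def E'_def)
  have im: "map_prod ?b ?b ` E' = E"
  proof
    show "E \<subseteq> map_prod ?b ?b ` E'"
    proof
      fix x assume x: "x \<in> E"
      then have "fst x \<in> V" "snd x \<in> V" using digraph_onD(3)[OF X(1)] by auto
      then obtain i j where "i \<in> ?I" "j \<in> ?I" "fst x = xs ! i" "snd x = xs ! j"
        using b unfolding bij_betw_def by (metis imageE)
      then show "x \<in> map_prod ?b ?b ` E'"
        using x by (intro image_eqI[of _ _ "(i, j)"]) (cases x, auto simp: E'_def)+
    qed
  qed (auto simp: E'_def)
  have injE: "inj_on (map_prod ?b ?b) E'" by (rule inj_map_prod[OF inj digraph_onD(3)[OF ok]])
  have "iso_type ?I E' = iso_type V E"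
  proof (rule iso_type_eqI[OF ok X(1)])
    show "card ?I = card V" using X by simp
    show "card E' = card E" using card_image[OF injE] im by simp
    show "inj_on ?b (Field E')" using inj digraph_onD(5)[OF ok] by (rule inj_on_subset)
  qed (simp add: im)
  moreover have "outdeg E' i = outdeg E (xs ! i)" if "i < nverts X" for i
  proof -
    have "inj_on ?b (E' `` {i})" using inj by (rule inj_on_subset) (auto simp: E'_def)
    then have "card (?b ` (E' `` {i})) = outdeg E' i" by (rule card_image)
    then show ?thesis using Image_map_prod[OF inj digraph_onD(3)[OF ok], of i] that unfolding im
      by simp
  qed
  ultimately show thesis using ok X(2) decr xs(3) by (intro that[of E']) auto
qed

text \<open>
  The number of pendants attached to vertex \<open>i\<close> of a digraph with \<open>m\<close> vertices, which has at most
  \<open>m * m\<close> edges. Each number is at least three times the next one: one copy dominates all degrees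
  inside the digraph, as well as the number of its edges, and the other two are the gap required
  by \<open>strip_pendants\<close>.
\<close>

definition pendants :: "nat \<Rightarrow> nat \<Rightarrow> nat" where
  "pendants m i = (m * m + 1) * 3 ^ (m - i)"

lemma pendants_decreasing: "i < j \<Longrightarrow> j \<le> m \<Longrightarrow> 3 * pendants m j \<le> pendants m i"
proof -
  assume "i < j" "j \<le> m"
  then have "Suc (m - j) \<le> m - i" by simp
  then have "(3::nat) ^ Suc (m - j) \<le> 3 ^ (m - i)" by (intro power_increasing) auto
  then have "(m * m + 1) * 3 ^ Suc (m - j) \<le> (m * m + 1) * 3 ^ (m - i)" by (rule mult_le_mono2)
  then show ?thesis by (simp add: pendants_def)
qed

lemma pendants_large: "m * m < pendants m i"
proof -
  have "(m * m + 1) * 1 \<le> (m * m + 1) * 3 ^ (m - i)" by (intro mult_le_mono2) simp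
  then show ?thesis by (simp add: pendants_def)
qed

text \<open>
  \<open>G j\<close> is the digraph with pendants at its first \<open>j\<close> vertices. For \<open>j = m\<close> it is a star forest
  with edges between the centres. The pendants are removed from the last vertex first: at the time
  when vertex \<open>j\<close> loses its pendants, the earlier vertices still have many more, and the later
  ones are bare and have out-degree at most that of \<open>j\<close>.
\<close>

theorem (in oriented_embedding) f_fixes_all:
  assumes n_large: "nverts X + (\<Sum>i<nverts X. pendants (nverts X) i) \<le> n"
  shows "f X = X"
proof -
  define m where "m = nverts X"
  obtain E :: "(nat \<times> nat) set" where E: "digraph_on {..<m} E" "X = iso_type {..<m} E"
    and decr: "\<forall>i j. i \<le> j \<longrightarrow> j < m \<longrightarrow> outdeg E j \<le> outdeg E i"
    unfolding m_def by (rule ex_sorted_iso_type[of X])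
  let ?D = "pendants m"
  let ?c = "\<lambda>i. (i, 0 :: nat)"
  let ?leaf = "\<lambda>(i, l). ((i, 0), (i, l))"
  define C where "C = ?c ` {..<m}"
  define E0 where "E0 = map_prod ?c ?c ` E"
  define Q where "Q j = (SIGMA i:{..<j}. {1..?D i})" for j
  define G where "G j = E0 \<union> ?leaf ` Q j" for j
  have inj: "inj_on ?c {..<m}" by (auto simp: inj_on_def)
  have C: "finite C" "C \<noteq> {}" "card C = m"
    using digraph_onD(2)[OF E(1)] card_image[OF inj] by (auto simp: C_def)
  have E0C: "E0 \<subseteq> C \<times> C" using digraph_onD(3)[OF E(1)] by (auto simp: E0_def C_def)
  have ok0: "digraph_on C E0" using C E0C by (simp add: digraph_on_def)
  have Qfin: "finite (Q j)" for j by (auto simp: Q_def)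
  have CQ: "C \<inter> Q j = {}" for j by (auto simp: C_def Q_def)
  have okG: "digraph_on (C \<union> Q j) (G j)" if "j \<le> m" for j
    using C Qfin E0C that by (auto simp: digraph_on_def G_def Q_def C_def)
  have size: "card (C \<union> Q j) \<le> n" if "j \<le> m" for j
  proof -
    have "card (C \<union> Q j) = m + (\<Sum>i<j. ?D i)"
      using C(1,3) Qfin CQ by (simp add: card_Un_disjoint) (simp add: Q_def)
    also have "(\<Sum>i<j. ?D i) \<le> (\<Sum>i<m. ?D i)" using that by (intro sum_mono2) auto
    finally show ?thesis using n_large by (simp add: m_def)
  qed
  have degE: "outdeg E i \<le> m" for i
  proof -
    have "E `` {i} \<subseteq> {..<m}" using digraph_onD(3)[OF E(1)] by auto
    then show ?thesis using card_mono[of "{..<m}" "E `` {i}"] by simp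
  qed
  have degE0: "outdeg E0 (?c i) = outdeg E i" if "i < m" for i
  proof -
    have "E0 `` {?c i} = ?c ` (E `` {i})"
      unfolding E0_def using Image_map_prod[OF inj digraph_onD(3)[OF E(1)], of i] that by simp
    then show ?thesis by (simp add: card_image inj_on_def)
  qed
  have degG: "outdeg (G j) (?c i) = outdeg E i + (if i < j then ?D i else 0)" if "i < m" for i j
  proof -
    have "outdeg (G j) (?c i) = outdeg E0 (?c i) + outdeg (?leaf ` Q j) (?c i)"
      unfolding G_def using digraph_onD(4)[OF ok0] Qfin E0C CQ[of j]
      by (intro outdeg_Un_disjoint) auto
    also have "(?leaf ` Q j) `` {?c i} = (if i < j then {i} \<times> {1..?D i} else {})"
      by (force simp: Q_def)
    finally show ?thesis using degE0[OF that] by (simp add: card_cartesian_product)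
  qed
  have top: "f (iso_type (C \<union> Q m) (G m)) = iso_type (C \<union> Q m) (G m)"
  proof -
    have leaves: "{q \<in> Q m. (\<lambda>(i, l). ?c i) q = ?c i} = {i} \<times> {1..?D i}" if "i < m" for i
      using that by (auto simp: Q_def)
    interpret star_forest n f C "Q m" "\<lambda>(i, l). ?c i" "m * m"
    proof
      fix c assume "c \<in> C"
      then obtain i where "c = ?c i" "i < m" by (auto simp: C_def)
      then show "m * m < card {q \<in> Q m. (\<lambda>(i, l). ?c i) q = c}"
        using leaves[of i] pendants_large[of m i] by (simp add: card_cartesian_product)
    next
      fix c c' assume "c \<in> C" "c' \<in> C" "c \<noteq> c'"
      then obtain i i' where i: "c = ?c i" "i < m" "c' = ?c i'" "i' < m" "i \<noteq> i'"
        by (auto simp: C_def)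
      have "?D i + m * m < ?D i' \<or> ?D i' + m * m < ?D i"
        using i pendants_decreasing[of i i' m] pendants_decreasing[of i' i m]
          pendants_large[of m i] pendants_large[of m i'] by linarith
      then show "card {q \<in> Q m. (\<lambda>(i, l). ?c i) q = c} + m * m < card {q \<in> Q m. (\<lambda>(i, l). ?c i) q = c'} \<or>
        card {q \<in> Q m. (\<lambda>(i, l). ?c i) q = c'} + m * m < card {q \<in> Q m. (\<lambda>(i, l). ?c i) q = c}"
        using leaves i by (simp add: card_cartesian_product)
    qed (use C Qfin CQ size in \<open>auto simp: C_def Q_def\<close>)
    have "card E \<le> card ({..<m} \<times> {..<m})" using digraph_onD(3)[OF E(1)] by (intro card_mono) auto
    then have "card E \<le> m * m" by (simp add: card_cartesian_product)
    moreover have "card E0 \<le> card E" unfolding E0_def using digraph_onD(4)[OF E(1)]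
      by (rule card_image_le)
    ultimately have "f (iso_type W (F \<union> E0)) = iso_type W (F \<union> E0)"
      using E0C by (intro f_forest_edges) auto
    moreover have "F \<union> E0 = G m" unfolding F_def G_def by (auto simp: case_prod_beta)
    ultimately show ?thesis by (simp add: W_def)
  qed
  have "f (iso_type (C \<union> Q 0) (G 0)) = iso_type (C \<union> Q 0) (G 0)"
  proof (rule inc_induct[where P = "\<lambda>j. f (iso_type (C \<union> Q j) (G j)) = iso_type (C \<union> Q j) (G j)",
        OF le0 top])
    fix j assume j: "j < m"
      and IH: "f (iso_type (C \<union> Q (Suc j)) (G (Suc j))) = iso_type (C \<union> Q (Suc j)) (G (Suc j))"
    let ?R = "{j} \<times> {1..?D j}"
    have QS: "Q (Suc j) = Q j \<union> ?R" by (auto simp: Q_def less_Suc_eq)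
    have "?leaf ` ?R = {?c j} \<times> ?R" by force
    then have GS: "G (Suc j) = G j \<union> {?c j} \<times> ?R" unfolding G_def QS image_Un by blast
    show "f (iso_type (C \<union> Q j) (G j)) = iso_type (C \<union> Q j) (G j)"
    proof (rule strip_pendants[of _ _ "?c j" ?R])
      show "digraph_on (C \<union> Q j) (G j)" using okG j by simp
      show "?c j \<in> C \<union> Q j" using j by (auto simp: C_def)
      show "?R \<inter> (C \<union> Q j) = {}" by (auto simp: C_def Q_def)
      show "card (C \<union> Q j \<union> ?R) \<le> n" using size[of "Suc j"] j by (simp add: QS Un_assoc)
      show "f (iso_type (C \<union> Q j \<union> ?R) (G j \<union> {?c j} \<times> ?R)) = iso_type (C \<union> Q j \<union> ?R) (G j \<union> {?c j} \<times> ?R)"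
        using IH by (simp only: QS GS Un_assoc)
      fix v assume "v \<in> C \<union> Q j"
      then consider i where "v = ?c i" "i < m" | "v \<in> Q j" by (auto simp: C_def)
      then show "outdeg (G j) v \<le> outdeg (G j) (?c j) \<or>
        outdeg (G j) (?c j) + 2 * card ?R \<le> outdeg (G j) v"
      proof cases
        case (1 i)
        show ?thesis
        proof (cases "i < j")
          case True
          have "outdeg E j \<le> ?D j" using degE[of j] pendants_large[of m j] le_square[of m]
            by linarith
          then have "outdeg E j + 2 * ?D j \<le> ?D i" using pendants_decreasing[of i j m] True j
            by linarith
          then show ?thesis
            using degG[of i j] degG[of j j] 1 True j by (simp add: card_cartesian_product)
        next
          case False
          then show ?thesis using degG[of i j] degG[of j j] 1 j decr by simp
        qed
      next
        case 2
        then have "G j `` {v} = {}" using E0C CQ[of j] by (auto simp: G_def Q_def)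
        then show ?thesis by simp
      qed
    qed simp
  qed
  moreover have "Q 0 = {}" "G 0 = E0" by (simp_all add: G_def Q_def)
  moreover have "iso_type {..<m} E = iso_type C E0"
  proof (rule iso_type_eqI[OF E(1) ok0, of ?c])
    show "card E = card E0"
      unfolding E0_def using card_image[OF inj_map_prod[OF inj digraph_onD(3)[OF E(1)]]] by simp
  qed (use C in \<open>auto simp: E0_def inj_on_def\<close>)
  ultimately show ?thesis using E(2) by simp
qed

lemma downset_embedding_id: "downset_embedding P id" if "\<And>X Y. X \<in> P \<Longrightarrow> Y \<le> X \<Longrightarrow> Y \<in> P"
  using that by (auto simp: downset_embedding_def)

theorem corollary9:
  fixes G :: digraph_type
  shows "fo_definable {G, transpose_type G}"
proof -
  define n where "n = 5 + nverts G + (\<Sum>i<nverts G. pendants (nverts G) i)"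
  have G: "G \<in> bounded n" by (simp add: bounded_def n_def)
  have "f G \<in> {G, transpose_type G}" if "downset_embedding (bounded n) f" for f
  proof -
    interpret bounded_embedding n f using that by unfold_locales (simp_all add: n_def)
    from f_loop_out_cases show ?thesis
    proof
      assume "f loop_out = loop_out"
      then interpret oriented_embedding n f by unfold_locales
      have "f G = G" by (rule f_fixes_all) (simp add: n_def)
      then show ?thesis by simp
    next
      assume rev: "f loop_out = transpose_type loop_out"
      interpret t: bounded_embedding n "\<lambda>X. transpose_type (f X)" by (rule transpose_f)
      interpret t: oriented_embedding n "\<lambda>X. transpose_type (f X)" by unfold_locales (simp add: rev)
      have "transpose_type (f G) = G" by (rule t.f_fixes_all) (simp add: n_def)
      then have "f G = transpose_type G" using transpose_transpose[of "f G"] by simp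
      then show ?thesis by simp
    qed
  qed
  moreover have id: "downset_embedding (bounded n) id"
    by (rule downset_embedding_id) (rule bounded_downset)
  moreover have "downset_embedding (bounded n) transpose_type"
  proof -
    interpret bounded_embedding n id using id by unfold_locales (simp_all add: n_def)
    interpret t: bounded_embedding n "\<lambda>X. transpose_type (id X)" by (rule transpose_f)
    from t.embedding show ?thesis by simp
  qed
  ultimately have "{f G | f. downset_embedding (bounded n) f} = {G, transpose_type G}"
    by (auto intro: exI[of _ id] exI[of _ transpose_type])
  with fo_definable_orbit[OF finite_bounded G] show ?thesis by simp
qed

end
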